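(* Let $Q=[-\pi/4,\pi/4]$ and let $h_0\in W^{1,\infty}(Q)$ be odd with respect to $\theta^*=0$ and non-negative on $[0,\pi/4]$. Let $h$ be the solution on $Q$ of $$\partial_th+2H\partial_\theta h=0,\qquad h(0,\theta)=h_0(\theta).$$ If $h_0(\pi/4)>0$, then $h(t,\cdot)$ converges to the odd stationary solution which equals $h_0(\pi/4)$ on $(0,\pi/4)$: $$\|h(t,\cdot)-h_0(\pi/4)\|_{L^1(0,\pi/4)}\to0,\qquad t\to\infty.$$ In addition, the gradient satisfies $$\|h'(t)\|_{L^\infty}\ge C\exp(ct),$$ with some constants $c,C>0$ depending only on the norm $\|h_0\|_{W^{1,\infty}}$.
   Context: The endpoints $\pm\pi/4$ of $Q$ are not identified. Prime denotes $\partial_\theta$. The system on $Q$ is understood as follows: an odd $h(t,\cdot)\in L^\infty(Q)$ is extended to the circle by $\tilde h(t,\theta)=h(t,\theta+k\pi/2)$, $k\in\mathbb{Z}$ (the $\pi/2$-periodic, possibly discontinuous, extension), and $H(t,\cdot)$ is the restriction to $Q$ of the unique solution on $S^1=[-\pi,\pi)$ of $4H+H''=\tilde h$, $\int_{-\pi}^\pi H(\theta)e^{\pm2i\theta}d\theta=0$ (so $H$ is odd and vanishes at $0,\pm\pi/4$). The solution satisfies $h(t,\phi(t,\theta))=h_0(\theta)$ with $\frac{d}{dt}\phi(t,\theta)=2H(t,\phi(t,\theta))$, $\phi(0,\theta)=\theta$; it is global, unique, stays odd and stays in $W^{1,\infty}(Q)$.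
   Formalization: The constants c, C are allowed to depend on the value h_0(π/4) as well as on the norm of h_0 in W^{1,∞}; with the norm alone the claim fails, e.g. for a bump near 0 plus a ramp of height ε→0 at π/4. *)

theory Defs
  imports "HOL-Analysis.Analysis" "HOL-Probability.Essential_Supremum"
begin

abbreviation Q :: "real set" where
  "Q \<equiv> {- (pi/4)..pi/4}"

definition odd_on :: "real set \<Rightarrow> (real \<Rightarrow> real) \<Rightarrow> bool" where
  "odd_on S f \<longleftrightarrow> (\<forall>x\<in>S. f (- x) = - f x)"

subsection \<open>The spaces $L^\infty$ and $W^{1,\infty}$\<close>

definition Linf_on :: "real set \<Rightarrow> (real \<Rightarrow> real) \<Rightarrow> bool" where
  "Linf_on S f \<longleftrightarrow>
     f \<in> borel_measurable (lebesgue_on S) \<and> (\<exists>B. AE x in lebesgue_on S. \<bar>f x\<bar> \<le> B)"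

text \<open>The conversion to \<^typ>\<open>real\<close> loses nothing on functions satisfying \<^const>\<open>Linf_on\<close>
  (on a set of positive measure).\<close>

definition Linf_norm :: "real set \<Rightarrow> (real \<Rightarrow> real) \<Rightarrow> real" where
  "Linf_norm S f = real_of_ereal (esssup (lebesgue_on S) (\<lambda>x. ereal \<bar>f x\<bar>))"

text \<open>Weak derivatives on the open interval $(a,b)$, tested against compactly supported
  $C^1$ functions.\<close>

definition test_fun :: "real \<Rightarrow> real \<Rightarrow> (real \<Rightarrow> real) \<Rightarrow> bool" where
  "test_fun a b \<psi> \<longleftrightarrow> \<psi> C1_differentiable_on UNIV \<and>
     compact (closure {x. \<psi> x \<noteq> 0}) \<and> closure {x. \<psi> x \<noteq> 0} \<subseteq> {a<..<b}"

definition has_weak_deriv :: "real \<Rightarrow> real \<Rightarrow> (real \<Rightarrow> real) \<Rightarrow> (real \<Rightarrow> real) \<Rightarrow> bool" where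
  "has_weak_deriv a b f g \<longleftrightarrow>
     (\<forall>\<psi>. test_fun a b \<psi> \<longrightarrow>
        (LINT x|lebesgue_on {a<..<b}. f x * deriv \<psi> x)
          = - (LINT x|lebesgue_on {a<..<b}. g x * \<psi> x))"

text \<open>Elements of $W^{1,\infty}$ are identified with their continuous representatives on the
  closed interval, so that point values, also at the endpoints, make sense.\<close>

definition W1inf :: "real \<Rightarrow> real \<Rightarrow> (real \<Rightarrow> real) \<Rightarrow> bool" where
  "W1inf a b f \<longleftrightarrow> continuous_on {a..b} f \<and> Linf_on {a<..<b} f \<and>
     (\<exists>g. Linf_on {a<..<b} g \<and> has_weak_deriv a b f g)"

text \<open>The weak derivative is unique up to null sets, so the norms below do not depend on
  the choice.\<close>

definition weak_deriv :: "real \<Rightarrow> real \<Rightarrow> (real \<Rightarrow> real) \<Rightarrow> real \<Rightarrow> real" where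
  "weak_deriv a b f = (SOME g. Linf_on {a<..<b} g \<and> has_weak_deriv a b f g)"

definition W1inf_norm :: "real \<Rightarrow> real \<Rightarrow> (real \<Rightarrow> real) \<Rightarrow> real" where
  "W1inf_norm a b f = Linf_norm {a<..<b} f + Linf_norm {a<..<b} (weak_deriv a b f)"

subsection \<open>The system on \<open>Q\<close>\<close>

text \<open>The $\pi/2$-periodic extension of a function on \<open>Q\<close>. At the seams
  $\pi/4 + k\pi/2$, a null set, the value at the left endpoint of \<open>Q\<close> is taken.\<close>

definition periodic_ext :: "(real \<Rightarrow> real) \<Rightarrow> real \<Rightarrow> real" where
  "periodic_ext f x = f (x - of_int \<lfloor>x / (pi/2) + 1/2\<rfloor> * (pi/2))"

lemma periodic_ext_shift:
  assumes "x \<in> {- (pi/4)..<pi/4}"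
  shows "periodic_ext f (x + of_int k * (pi/2)) = f x"
proof -
  have "(x + of_int k * (pi/2)) / (pi/2) + 1/2 = (x / (pi/2) + 1/2) + of_int k"
    by (simp add: field_simps)
  moreover have "\<lfloor>x / (pi/2) + 1/2\<rfloor> = 0"
    using assms by (simp add: floor_eq_iff field_simps)
  ultimately have "\<lfloor>(x + of_int k * (pi/2)) / (pi/2) + 1/2\<rfloor> = k"
    by (metis add_0 floor_add_int)
  then show ?thesis
    by (simp add: periodic_ext_def)
qed

text \<open>\<open>circle_velocity f H\<close>: the function \<open>H\<close> on the circle, represented as a $2\pi$-periodic
  function on the line, solves $4H + H'' = \tilde f$, where \<open>f\<close> is given on \<open>Q\<close>, and its Fourier
  modes $\pm 2$ vanish. As $\tilde f$ is only bounded, the equation is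
  understood in $W^{2,\infty}$: \<open>H\<close> is differentiable with derivative \<open>G\<close>, and \<open>G\<close> is an indefinite
  integral of $\tilde f - 4H$.\<close>

definition circle_velocity :: "(real \<Rightarrow> real) \<Rightarrow> (real \<Rightarrow> real) \<Rightarrow> bool" where
  "circle_velocity f H \<longleftrightarrow>
     (\<forall>x. H (x + 2 * pi) = H x) \<and>
     (\<exists>G. (\<forall>x. (H has_real_derivative G x) (at x)) \<and>
          (\<forall>a b. a \<le> b \<longrightarrow>
             ((\<lambda>x. periodic_ext f x - 4 * H x) has_integral (G b - G a)) {a..b})) \<and>
     ((\<lambda>x. complex_of_real (H x) * exp (2 * \<i> * complex_of_real x)) has_integral 0) {- pi..pi} \<and>
     ((\<lambda>x. complex_of_real (H x) * exp (- 2 * \<i> * complex_of_real x)) has_integral 0) {- pi..pi}"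

text \<open>Global odd Lagrangian solutions of $\partial_t h + 2H\partial_\theta h = 0$ on \<open>Q\<close>, with
  $h \in L^\infty_{loc}([0,\infty); L^\infty(Q))$. No continuity in $\theta$ is required, so that
  discontinuous stationary states are covered too.\<close>

definition solution_on_Q :: "(real \<Rightarrow> real) \<Rightarrow> (real \<Rightarrow> real \<Rightarrow> real) \<Rightarrow> bool" where
  "solution_on_Q h0 h \<longleftrightarrow>
     (\<forall>t\<ge>0. odd_on Q (h t) \<and> Linf_on Q (h t)) \<and>
     (\<forall>T. \<exists>B. \<forall>t\<in>{0..T}. Linf_norm Q (h t) \<le> B) \<and>
     (\<exists>H \<phi>. (\<forall>t\<ge>0. circle_velocity (h t) (H t)) \<and>
        (\<forall>\<theta>\<in>Q. \<phi> 0 \<theta> = \<theta>) \<and>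
        (\<forall>t\<ge>0. \<forall>\<theta>\<in>Q. \<phi> t \<theta> \<in> Q \<and>
           ((\<lambda>s. \<phi> s \<theta>) has_real_derivative 2 * H t (\<phi> t \<theta>)) (at t within {0..}) \<and>
           h t (\<phi> t \<theta>) = h0 \<theta>))"

definition stationary_on_Q :: "(real \<Rightarrow> real) \<Rightarrow> bool" where
  "stationary_on_Q s \<longleftrightarrow> solution_on_Q s (\<lambda>t. s)"

definition odd_step :: "real \<Rightarrow> real \<Rightarrow> real" where
  "odd_step a \<theta> = a * sgn \<theta>"

end

theory Submission
  imports Defs
begin

text \<open>On $[0,\pi/4]$ the velocity solves the Dirichlet problem for $4H + H'' = h$, whose Green function
  is negative; hence $H \le 0$ and particles move towards \<open>0\<close> while $\pi/4$ stays fixed. The profile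
  near $\pi/4$ therefore never drops below $h_0(\pi/4)/2$ on an interval of length
  $d = h_0(\pi/4)/(2\|h_0\|)$, which gives $2H \le -\kappa \sin 4\theta$ with $\kappa$ independent of
  time, and $\tan 2\phi$ decays like $e^{-4\kappa t}$ along trajectories. So the particle seen at a
  fixed $\theta \in (0,\pi/4)$ started ever closer to $\pi/4$, which gives the convergence, while the
  particle started at $\pi/4 - d$ carries a value at least $h_0(\pi/4)/2$ exponentially close to the
  zero of \<open>h\<close> at the origin, which makes the gradient grow.\<close>

section \<open>Lipschitz bounds from bounded weak derivatives\<close>

text \<open>\<open>solution_on_Q\<close> only says that some velocity and some flow exist. Oddness
  of H about 0 and pi/4, its Green representation, the fixed endpoints and the reachability of every
  point are therefore extracted from the defining equations. The operator 4 + d^2/dx^2 has the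
  kernel cos 2x, sin 2x on the circle, so symmetry of the data gives symmetry of H only through the
  Fourier condition. The sign H <= 0 must be known before the quantitative bound: it makes particles
  move towards 0, which preserves the lower bound of h near pi/4, and only this lower bound makes
  kappa positive. The substitution tan 2x is chosen because it linearises x' = -kappa sin 4x: it
  turns the equation into w' = -4 kappa w. Weak derivatives enter only through the fact that their
  sup norm is a Lipschitz constant. For h0 this fixes d; for h(t) a steep difference quotient bounds
  the norm from below. The constants c and C are explicit functions of the norm M of h0 and of a =
  h0(pi/4). Stationarity of the step is checked separately with an explicit velocity and flow, since
  the estimates for h(t) assume continuity.\<close>

lemma AE_abs_le_Linf_norm:
  assumes "Linf_on S f"
  shows "AE x in lebesgue_on S. \<bar>f x\<bar> \<le> Linf_norm S f"
proof -
  obtain B where [measurable]: "f \<in> borel_measurable (lebesgue_on S)"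
    and B: "AE x in lebesgue_on S. \<bar>f x\<bar> \<le> B"
    using assms by (auto simp: Linf_on_def)
  define e where "e = esssup (lebesgue_on S) (\<lambda>x. ereal \<bar>f x\<bar>)"
  have le: "AE x in lebesgue_on S. ereal \<bar>f x\<bar> \<le> e"
    unfolding e_def by (rule esssup_AE)
  have "e \<le> ereal B"
    unfolding e_def using B by (intro esssup_I) auto
  \<comment> \<open>\<open>real_of_ereal\<close> sends infinity to 0, so passing to a real bound
    needs a finite essential supremum.\<close>
  then have "e \<noteq> \<infinity>" by auto
  then have "\<bar>y\<bar> \<le> real_of_ereal e" if "ereal \<bar>y\<bar> \<le> e" for y
    using that by (cases e) auto
  with le show ?thesis
    unfolding Linf_norm_def e_def by (auto elim: eventually_mono)
qed

lemma Linf_norm_interval_nonneg: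
  assumes "Linf_on {a<..<b} f" "a < b"
  shows "0 \<le> Linf_norm {a<..<b} f"
proof -
  have "emeasure (lebesgue_on {a<..<b}) (space (lebesgue_on {a<..<b})) \<noteq> 0"
    using assms(2) by (simp add: emeasure_restrict_space)
  then have "ae_filter (lebesgue_on {a<..<b}) \<noteq> bot"
    by (simp add: ae_filter_eq_bot_iff)
  then obtain x where "\<bar>f x\<bar> \<le> Linf_norm {a<..<b} f"
    using eventually_happens'[OF _ AE_abs_le_Linf_norm[OF assms(1)]] by auto
  then show ?thesis by linarith
qed

text \<open>The set where the bound holds is closed, and a closed set containing almost every point
  of an open interval contains all of it; continuity then adds the endpoints.\<close>

lemma continuous_AE_le:
  fixes f :: "real \<Rightarrow> real"
  assumes "a < b" and cont: "continuous_on {a..b} f"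
    and AE: "AE x in lebesgue_on {a..b}. \<bar>f x\<bar> \<le> B" and "x \<in> {a..b}"
  shows "\<bar>f x\<bar> \<le> B"
proof -
  have cl: "closed {x\<in>{a..b}. \<bar>f x\<bar> \<le> B}"
    by (intro continuous_on_closed_Collect_le continuous_intros cont)
  have "AE x\<in>{a<..<b} in lebesgue. x \<in> {x\<in>{a..b}. \<bar>f x\<bar> \<le> B}"
    using AE by (subst (asm) AE_restrict_space_iff) (auto elim: eventually_mono)
  then have *: "\<bar>f y\<bar> \<le> B" if "y \<in> {a<..<b}" for y
    using mem_closed_if_AE_lebesgue_open[OF open_greaterThanLessThan cl _ that] by auto
  have "(\<lambda>x. \<bar>f x\<bar>) x \<le> B"
    by (rule continuous_le_on_closure[where S="{a<..<b}"])
       (use assms * in \<open>auto intro!: continuous_intros\<close>)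
  then show ?thesis .
qed

lemma indefinite_integral_DERIV_within:
  fixes F g :: "real \<Rightarrow> real"
  assumes g: "continuous_on {a..b} g"
    and F: "\<And>y. y \<in> {a..b} \<Longrightarrow> (g has_integral (F y - F a)) {a..y}" and x: "x \<in> {a..b}"
  shows "(F has_real_derivative g x) (at x within {a..b})"
proof -
  have eq: "F a + integral {a..y} g = F y" if "y \<in> {a..b}" for y
    using F[OF that] by (simp add: integral_unique)
  have "((\<lambda>y. F a + integral {a..y} g) has_real_derivative g x) (at x within {a..b})"
    using integral_has_real_derivative[OF g x] by (auto intro!: derivative_eq_intros)
  then show ?thesis
    by (rule has_field_derivative_transform_within[where d=1]) (use x in \<open>simp_all add: eq\<close>)
qed

lemma indefinite_integral_DERIV:
  fixes F g :: "real \<Rightarrow> real"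
  assumes g: "continuous_on UNIV g" and F: "\<And>a b. a \<le> b \<Longrightarrow> (g has_integral (F b - F a)) {a..b}"
  shows "(F has_real_derivative g x) (at x)"
proof -
  have "(F has_real_derivative g x) (at x within {x-1..x+1})"
    by (rule indefinite_integral_DERIV_within) (use F in \<open>auto intro: continuous_on_subset[OF g]\<close>)
  then show ?thesis
    by (simp add: at_within_Icc_at)
qed

text \<open>The fundamental theorem tolerates finitely many exceptional points for continuous
  \<open>f\<close>, so \<open>f\<close> is an indefinite integral of \<open>g\<close>; continuity of
  \<open>g\<close> then yields the derivative at the exceptional points too. This serves both the
  clamped cubic ramp and the stationary velocity at its kinks.\<close>

lemma DERIV_across_exceptional_points:
  fixes f g :: "real \<Rightarrow> real"
  assumes f: "continuous_on UNIV f" and g: "continuous_on UNIV g"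
    and S: "\<And>a b. finite (S \<inter> {a..b})"
    and deriv: "\<And>x. x \<notin> S \<Longrightarrow> (f has_real_derivative g x) (at x)"
  shows "(f has_real_derivative g x) (at x)"
proof (rule indefinite_integral_DERIV[OF g])
  fix a b :: real assume "a \<le> b"
  then show "(g has_integral (f b - f a)) {a..b}"
    by (intro fundamental_theorem_of_calculus_strong[OF S[of a b]])
       (use deriv in \<open>auto simp: has_real_derivative_iff_has_vector_derivative
          intro: continuous_on_subset[OF f]\<close>)
qed

section \<open>Smooth ramps as test functions and approximate identities\<close>

definition smooth_step :: "real \<Rightarrow> real" where
  "smooth_step u = 3 * (max 0 (min 1 u))^2 - 2 * (max 0 (min 1 u))^3"

text \<open>The derivative of the ramp. The factor u(1 - u) vanishes at both ends, so the clamped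
  cubic is C^1, which is all that \<open>test_fun\<close> asks; the 6 gives the kernel unit
  mass.\<close>

definition step_kernel :: "real \<Rightarrow> real" where
  "step_kernel u = max 0 (6 * u * (1 - u))"

lemma step_kernel_nonneg: "0 \<le> step_kernel u"
  by (simp add: step_kernel_def)

lemma step_kernel_eq_0: "u \<le> 0 \<or> 1 \<le> u \<Longrightarrow> step_kernel u = 0"
  by (auto simp: step_kernel_def max_def mult_le_0_iff zero_le_mult_iff)

lemma step_kernel_eq: "0 \<le> u \<Longrightarrow> u \<le> 1 \<Longrightarrow> step_kernel u = 6 * u * (1 - u)"
  by (auto simp: step_kernel_def max_def mult_le_0_iff zero_le_mult_iff)

lemma continuous_on_step_kernel: "continuous_on S step_kernel"
  unfolding step_kernel_def by (intro continuous_intros)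

lemma smooth_step_eq_0: "u \<le> 0 \<Longrightarrow> smooth_step u = 0"
  and smooth_step_eq_1: "1 \<le> u \<Longrightarrow> smooth_step u = 1"
  by (simp_all add: smooth_step_def)

lemma DERIV_smooth_step: "(smooth_step has_real_derivative step_kernel u) (at u)"
proof (rule DERIV_across_exceptional_points[where S="{0,1}"])
  show "continuous_on UNIV smooth_step"
    unfolding smooth_step_def by (intro continuous_intros)
  show "(smooth_step has_real_derivative step_kernel x) (at x)" if x: "x \<notin> {0,1}" for x
  proof -
    consider "x < 0" | "0 < x" "x < 1" | "1 < x" using x by force
    then show ?thesis
    proof cases
      case 1
      then have "((\<lambda>u. 0) has_real_derivative step_kernel x) (at x)"
        by (simp add: step_kernel_eq_0)
      then show ?thesis
        by (rule has_field_derivative_transform_within_open[where S="{..<0}"])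
           (use 1 in \<open>auto simp: smooth_step_eq_0\<close>)
    next
      case 2
      then have "((\<lambda>u::real. 3 * u^2 - 2 * u^3) has_real_derivative step_kernel x) (at x)"
        by (auto intro!: derivative_eq_intros simp: step_kernel_eq power2_eq_square algebra_simps)
      then show ?thesis
        by (rule has_field_derivative_transform_within_open[where S="{0<..<1}"])
           (use 2 in \<open>auto simp: smooth_step_def\<close>)
    next
      case 3
      then have "((\<lambda>u. 1) has_real_derivative step_kernel x) (at x)"
        by (simp add: step_kernel_eq_0)
      then show ?thesis
        by (rule has_field_derivative_transform_within_open[where S="{1<..}"])
           (use 3 in \<open>auto simp: smooth_step_eq_1\<close>)
    qed
  qed
qed (auto simp: continuous_on_step_kernel)

lemma DERIV_ramp:
  assumes "0 < e"
  shows "((\<lambda>s. smooth_step ((s - x) / e)) has_real_derivative step_kernel ((s - x) / e) / e)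
    (at s within S)"
proof -
  have "((\<lambda>s. (s - x) / e) has_real_derivative 1 / e) (at s within S)"
    using assms by (auto intro!: derivative_eq_intros)
  from DERIV_chain2[OF DERIV_smooth_step this] show ?thesis by simp
qed

lemma mono_smooth_step: "u \<le> v \<Longrightarrow> smooth_step u \<le> smooth_step v"
  by (rule DERIV_nonneg_imp_nondecreasing) (auto intro: DERIV_smooth_step step_kernel_nonneg)

text \<open>The difference of the two ramps is admissible as a test function; its derivative is an
  approximate identity at $x$ minus one at $y$.\<close>

definition trapezoid :: "real \<Rightarrow> real \<Rightarrow> real \<Rightarrow> real \<Rightarrow> real" where
  "trapezoid x y e s = smooth_step ((s - x) / e) - smooth_step ((s - y) / e)"

lemma DERIV_trapezoid:
  assumes "0 < e"
  shows "(trapezoid x y e has_real_derivative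
     step_kernel ((s - x) / e) / e - step_kernel ((s - y) / e) / e) (at s)"
  unfolding trapezoid_def by (intro DERIV_diff DERIV_ramp assms)

lemma trapezoid_support:
  assumes "0 < e" "s \<notin> {x..y+e}" "x < y"
  shows "trapezoid x y e s = 0"
proof -
  consider "s < x" | "s > y + e" using assms(2) by force
  then show ?thesis
    using assms by cases (simp_all add: trapezoid_def smooth_step_eq_0 smooth_step_eq_1 divide_le_0_iff)
qed

lemma trapezoid_bounds:
  assumes "0 < e" "x < y"
  shows "0 \<le> trapezoid x y e s" "trapezoid x y e s \<le> 1"
proof -
  show "0 \<le> trapezoid x y e s"
    using assms by (auto simp: trapezoid_def intro!: mono_smooth_step divide_right_mono)
  have "smooth_step ((s - x) / e) \<le> 1"
    using mono_smooth_step[of "(s - x) / e" "max 1 ((s - x) / e)"] by (simp add: smooth_step_eq_1)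
  moreover have "smooth_step ((s - y) / e) \<ge> 0"
    using mono_smooth_step[of "min 0 ((s - y) / e)" "(s - y) / e"] by (simp add: smooth_step_eq_0)
  ultimately show "trapezoid x y e s \<le> 1"
    by (simp add: trapezoid_def)
qed

lemma test_fun_trapezoid:
  assumes "a < x" "x < y" "y + e < b" "0 < e"
  shows "test_fun a b (trapezoid x y e)"
proof -
  have cl: "closure {s. trapezoid x y e s \<noteq> 0} \<subseteq> {x..y+e}"
    by (rule closure_minimal) (use assms trapezoid_support[of e _ x y] in \<open>force+\<close>)
  have "trapezoid x y e C1_differentiable_on UNIV"
    unfolding C1_differentiable_on_def
    by (rule exI[where x="\<lambda>s. step_kernel ((s - x) / e) / e - step_kernel ((s - y) / e) / e"])
       (use assms in \<open>auto simp flip: has_real_derivative_iff_has_vector_derivative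
          intro!: DERIV_trapezoid continuous_intros continuous_on_compose2[OF continuous_on_step_kernel[of UNIV]]\<close>)
  then show ?thesis
    unfolding test_fun_def
    using cl assms by (auto simp: compact_eq_bounded_closed intro: bounded_subset[OF bounded_closed_interval])
qed

lemma has_integral_step_kernel:
  assumes "0 < e" "a \<le> x" "x + e \<le> b"
  shows "((\<lambda>s. step_kernel ((s - x) / e) / e) has_integral 1) {a..b}"
proof -
  have "((\<lambda>s. step_kernel ((s - x) / e) / e) has_integral
     (smooth_step ((b - x) / e) - smooth_step ((a - x) / e))) {a..b}"
    by (rule fundamental_theorem_of_calculus)
       (use assms in \<open>auto simp flip: has_real_derivative_iff_has_vector_derivative intro!: DERIV_ramp\<close>)
  then show ?thesis
    using assms by (simp add: smooth_step_eq_0 smooth_step_eq_1 divide_le_0_iff)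
qed

text \<open>The rescaled kernel is nonnegative, has mass 1 and lives on [x, x+e], so it averages
  \<open>f\<close> over points where \<open>f\<close> is within \<open>d\<close> of
  \<open>f x\<close>.\<close>

lemma step_kernel_average:
  assumes f: "continuous_on {a..b} f" and "a \<le> x" "x + e \<le> b" "0 < e"
    and d: "\<And>s. s \<in> {x..x+e} \<Longrightarrow> \<bar>f s - f x\<bar> \<le> d"
  shows "\<bar>integral {a..b} (\<lambda>s. f s * (step_kernel ((s - x) / e) / e)) - f x\<bar> \<le> d"
proof -
  let ?k = "\<lambda>s. step_kernel ((s - x) / e) / e"
  have k: "(?k has_integral 1) {a..b}"
    using assms by (intro has_integral_step_kernel)
  have int: "(\<lambda>s. f s * ?k s) integrable_on {a..b}"
    by (intro integrable_continuous_real continuous_intros f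
          continuous_on_compose2[OF continuous_on_step_kernel[of UNIV]]) (use assms in auto)
  have 1: "((\<lambda>s. f s * ?k s - f x * ?k s) has_integral (integral {a..b} (\<lambda>s. f s * ?k s) - f x * 1)) {a..b}"
    by (intro has_integral_diff integrable_integral int has_integral_mult_right k)
  have 2: "((\<lambda>s. d * ?k s) has_integral d * 1) {a..b}"
    by (intro has_integral_mult_right k)
  have "norm (f s * ?k s - f x * ?k s) \<le> d * ?k s" for s
  proof (cases "s \<in> {x..x+e}")
    case True
    have "norm (f s * ?k s - f x * ?k s) = \<bar>f s - f x\<bar> * ?k s"
      using \<open>0 < e\<close> step_kernel_nonneg[of "(s - x) / e"]
      by (simp only: left_diff_distrib[symmetric]) (simp add: abs_mult)
    also have "\<dots> \<le> d * ?k s"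
      using d[OF True] \<open>0 < e\<close> by (intro mult_right_mono) (auto simp: step_kernel_nonneg)
    finally show ?thesis .
  next
    case False
    then have "?k s = 0"
      using \<open>0 < e\<close> by (subst step_kernel_eq_0) (auto simp: field_simps)
    then show ?thesis by (simp only: mult_zero_right)  simp
  qed
  then have "norm (integral {a..b} (\<lambda>s. f s * ?k s - f x * ?k s)) \<le> integral {a..b} (\<lambda>s. d * ?k s)"
    by (intro integral_norm_bound_integral has_integral_integrable[OF 1] has_integral_integrable[OF 2])
  then show ?thesis
    unfolding integral_unique[OF 1] integral_unique[OF 2] by simp
qed

text \<open>Testing with the trapezoid moves the derivative onto the two kernels on one side. On the
  other side the trapezoid is at most 1 and supported in [x, y+e], so the integral against
  \<open>g\<close> is at most the sup norm times the length of that interval.\<close>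

lemma weak_deriv_test_bound:
  assumes f: "continuous_on {a..b} f" and g: "Linf_on {a<..<b} g" and fg: "has_weak_deriv a b f g"
    and xy: "a < x" "x < y" "y + e < b" "0 < e"
  shows "\<bar>integral {a..b} (\<lambda>s. f s * (step_kernel ((s - x) / e) / e)) -
          integral {a..b} (\<lambda>s. f s * (step_kernel ((s - y) / e) / e))\<bar>
         \<le> Linf_norm {a<..<b} g * (y + e - x)" (is "\<bar>?X - ?Y\<bar> \<le> ?N * _")
proof -
  let ?T = "trapezoid x y e"
  let ?d = "\<lambda>s. step_kernel ((s - x) / e) / e - step_kernel ((s - y) / e) / e"
  have dT: "deriv ?T = ?d"
    using DERIV_trapezoid[OF xy(4)] by (auto intro!: DERIV_imp_deriv)
  have N: "0 \<le> ?N" using Linf_norm_interval_nonneg[OF g] xy by simp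
  have c: "continuous_on {a..b} (\<lambda>s. f s * ?d s)"
    "continuous_on {a..b} (\<lambda>s. f s * (step_kernel ((s - x) / e) / e))"
    "continuous_on {a..b} (\<lambda>s. f s * (step_kernel ((s - y) / e) / e))"
    using xy by (auto intro!: continuous_intros f continuous_on_compose2[OF continuous_on_step_kernel[of UNIV]])
  have "integrable (lebesgue_on {a<..<b}) (\<lambda>s. f s * ?d s)"
  proof -
    have "set_integrable lebesgue {a..b} (\<lambda>s. f s * ?d s)"
      using c(1) by (rule absolutely_integrable_continuous_real)
    then have "set_integrable lebesgue {a<..<b} (\<lambda>s. f s * ?d s)"
      by (rule set_integrable_subset) auto
    then show ?thesis
      by (subst integrable_restrict_space) (simp_all only: set_integrable_def, simp)
  qed
  then have "(LINT s|lebesgue_on {a<..<b}. f s * deriv ?T s) = integral {a<..<b} (\<lambda>s. f s * ?d s)"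
    unfolding dT by (simp add: lebesgue_integral_eq_integral)
  also have "\<dots> = integral {a..b} (\<lambda>s. f s * ?d s)"
    by (simp add: integral_open_interval_real)
  also have "\<dots> = ?X - ?Y"
    using c by (simp add: right_diff_distrib integral_diff integrable_continuous_real)
  finally have 1: "?X - ?Y = - (LINT s|lebesgue_on {a<..<b}. g s * ?T s)"
    using fg test_fun_trapezoid[OF xy] by (simp add: has_weak_deriv_def)
  have [simp]: "measure (lebesgue_on {a<..<b}) {x..y+e} = y + e - x"
    using xy by (subst measure_restrict_space) auto
  have [simp]: "{x..y+e} \<in> sets (lebesgue_on {a<..<b})"
    using xy by (auto simp: sets_restrict_space_iff)
  have [simp]: "emeasure (lebesgue_on {a<..<b}) {x..y+e} < top"
    using xy by (subst emeasure_restrict_space) auto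
  have ind: "integrable (lebesgue_on {a<..<b}) (\<lambda>s. ?N * indicator {x..y+e} s)"
    by (intro integrable_mult_right integrable_real_indicator) simp_all
  have le: "AE s in lebesgue_on {a<..<b}. norm (g s * ?T s) \<le> ?N * indicator {x..y+e} s"
    using AE_abs_le_Linf_norm[OF g]
  proof eventually_elim
    case (elim s)
    show ?case
    proof (cases "s \<in> {x..y+e}")
      case True
      then show ?thesis
        using mult_mono[OF elim trapezoid_bounds(2)[OF xy(4,2)]] N trapezoid_bounds(1)[OF xy(4,2)]
        by (simp add: abs_mult)
    qed (use xy trapezoid_support in auto)
  qed
  have [measurable]: "g \<in> borel_measurable (lebesgue_on {a<..<b})"
    using g by (simp add: Linf_on_def)
  have "continuous_on {a<..<b} ?T"
    by (rule continuous_at_imp_continuous_on) (blast intro: DERIV_isCont DERIV_trapezoid xy(4))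
  then have [measurable]: "?T \<in> borel_measurable (lebesgue_on {a<..<b})"
    by (rule continuous_imp_measurable_on_sets_lebesgue) simp
  have "\<bar>LINT s|lebesgue_on {a<..<b}. g s * ?T s\<bar> \<le> (LINT s|lebesgue_on {a<..<b}. norm (g s * ?T s))"
    using integral_norm_bound[of "lebesgue_on {a<..<b}" "\<lambda>s. g s * ?T s"] by simp
  also have "\<dots> \<le> (LINT s|lebesgue_on {a<..<b}. ?N * indicator {x..y+e} s)"
  proof (rule integral_mono_AE[OF _ ind le])
    show "integrable (lebesgue_on {a<..<b}) (\<lambda>s. norm (g s * ?T s))"
      by (rule Bochner_Integration.integrable_bound[OF ind]) (use le in \<open>auto elim!: eventually_mono\<close>)
  qed
  also have "{x..y+e} \<inter> {a<..<b} = {x..y+e}"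
    using xy by auto
  then have "(LINT s|lebesgue_on {a<..<b}. ?N * indicator {x..y+e} s) = ?N * (y + e - x)"
    by simp
  finally show ?thesis
    unfolding 1 by simp
qed

text \<open>Narrowing the ramps turns the two kernel averages into the point values of
  \<open>f\<close>. The open interval comes first, where test functions fit; the closed one follows
  by continuity.\<close>

lemma weak_deriv_imp_lipschitz:
  assumes f: "continuous_on {a..b} f" and g: "Linf_on {a<..<b} g" and fg: "has_weak_deriv a b f g"
    and "a < b"
  shows "(Linf_norm {a<..<b} g)-lipschitz_on {a..b} f"
proof -
  let ?N = "Linf_norm {a<..<b} g"
  have N: "0 \<le> ?N" using Linf_norm_interval_nonneg[OF g \<open>a < b\<close>] .
  have le: "\<bar>f x - f y\<bar> \<le> ?N * (y - x)" if xy: "a < x" "x < y" "y < b" for x y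
  proof (rule field_le_epsilon)
    fix \<epsilon> :: real assume "0 < \<epsilon>"
    \<comment> \<open>Each of the two averaging errors costs \<open>d\<close>, and the excess length
      e <= d of the support costs at most \<open>?N * d\<close>.\<close>
    define d where "d = \<epsilon> / (2 + ?N)"
    have d: "0 < d" "(2 + ?N) * d = \<epsilon>"
      using \<open>0 < \<epsilon>\<close> N by (auto simp: d_def)
    have *: "\<exists>e>0. \<forall>s\<in>{a..b}. \<bar>s - z\<bar> < e \<longrightarrow> \<bar>f s - f z\<bar> < d" if "z \<in> {a..b}" for z
      using f d(1) that unfolding continuous_on_iff dist_real_def by blast
    obtain e1 e2 where e1: "e1 > 0" "\<And>s. s\<in>{a..b} \<Longrightarrow> \<bar>s - x\<bar> < e1 \<Longrightarrow> \<bar>f s - f x\<bar> < d"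
      and e2: "e2 > 0" "\<And>s. s\<in>{a..b} \<Longrightarrow> \<bar>s - y\<bar> < e2 \<Longrightarrow> \<bar>f s - f y\<bar> < d"
      using *[of x] *[of y] xy by auto
    define e where "e = min (min (e1/2) (e2/2)) (min ((b - y) / 2) d)"
    have e: "0 < e" "e < e1" "e < e2" "y + e < b" "e \<le> d"
      using e1(1) e2(1) xy d by (auto simp: e_def min_def field_simps)
    let ?I = "\<lambda>x. integral {a..b} (\<lambda>s. f s * (step_kernel ((s - x) / e) / e))"
    have "\<bar>?I x - f x\<bar> \<le> d"
      using e xy by (intro step_kernel_average f less_imp_le[OF e1(2)]) auto
    moreover have "\<bar>?I y - f y\<bar> \<le> d"
      using e xy by (intro step_kernel_average f less_imp_le[OF e2(2)]) auto
    moreover have "\<bar>?I x - ?I y\<bar> \<le> ?N * (y + e - x)"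
      using e xy by (intro weak_deriv_test_bound[OF f g fg])
    moreover have "?N * (y + e - x) \<le> ?N * (y - x) + ?N * d"
      using mult_left_mono[OF e(5) N] by (simp add: algebra_simps)
    ultimately show "\<bar>f x - f y\<bar> \<le> ?N * (y - x) + \<epsilon>"
      using d(2) by (auto simp: algebra_simps)
  qed
  have "?N-lipschitz_on {a<..<b} f"
  proof (rule lipschitz_onI[OF _ N])
    fix x y assume "x \<in> {a<..<b}" "y \<in> {a<..<b}"
    then show "dist (f x) (f y) \<le> ?N * dist x y"
      using le[of x y] le[of y x] by (cases x y rule: linorder_cases) (auto simp: dist_real_def)
  qed
  then show ?thesis
    using lipschitz_on_closure[of ?N "{a<..<b}" f] f \<open>a < b\<close> by simp
qed

lemma W1inf_imp_lipschitz:
  assumes "W1inf a b f" "a < b"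
  shows "(Linf_norm {a<..<b} (weak_deriv a b f))-lipschitz_on {a..b} f"
proof -
  have "\<exists>g. Linf_on {a<..<b} g \<and> has_weak_deriv a b f g"
    using assms by (simp add: W1inf_def)
  then have "Linf_on {a<..<b} (weak_deriv a b f) \<and> has_weak_deriv a b f (weak_deriv a b f)"
    unfolding weak_deriv_def by (rule someI_ex)
  moreover have "continuous_on {a..b} f"
    using assms(1) by (simp add: W1inf_def)
  ultimately show ?thesis
    using assms(2) weak_deriv_imp_lipschitz by blast
qed

section \<open>Symmetries and bounds of the velocity\<close>

lemma integral_over_period:
  fixes F :: "real \<Rightarrow> 'a::euclidean_space"
  assumes cont: "continuous_on UNIV F" and per: "\<And>x. F (x + p) = F x" and c: "0 \<le> c" "c \<le> p"
  shows "integral {a+c..a+c+p} F = integral {a..a+p} F"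
proof -
  have int: "F integrable_on {u..v}" for u v
    by (intro integrable_continuous_interval continuous_on_subset[OF cont]) simp
  have "integral {a+c..a+c+p} F = integral {a+c..a+p} F + integral {a+p..a+c+p} F"
    using c by (intro Henstock_Kurzweil_Integration.integral_combine[symmetric] int) auto
  also have "integral {a+p..a+c+p} F = integral {a..a+c} F"
    using integral_shift_real_ivl[of "a+p" p "a+c+p" F] by (simp add: per)
  also have "integral {a+c..a+p} F + integral {a..a+c} F = integral {a..a+p} F"
    using c by (subst add.commute, intro Henstock_Kurzweil_Integration.integral_combine int) auto
  finally show ?thesis .
qed

lemma has_integral_reflect_shift:
  fixes F :: "real \<Rightarrow> real"
  assumes "(F has_integral I) {c-b..c-a}"
  shows "((\<lambda>x. F (c - x)) has_integral I) {a..b}"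
proof -
  have "((\<lambda>x. F (- x)) has_integral I) {a-c..b-c}"
    using assms by (subst has_integral_reflect_real[symmetric]) simp
  from has_integral_shift_real_ivl[OF this, of "-c"] show ?thesis
    by simp
qed

text \<open>Two quantities are conserved, E cos 2x + 2 D sin 2x and E sin 2x - 2 D cos 2x; solving
  this linear system for D gives the formula. Continuity of D upgrades the integrated equation for E
  to a pointwise one.\<close>

lemma harmonic_oscillator:
  fixes D E :: "real \<Rightarrow> real"
  assumes D: "\<And>x. (D has_real_derivative E x) (at x)"
    and E: "\<And>a b. a \<le> b \<Longrightarrow> ((\<lambda>x. - 4 * D x) has_integral (E b - E a)) {a..b}"
  obtains A B where "\<And>x. D x = A * cos (2*x) + B * sin (2*x)"
proof -
  have "continuous_on UNIV D"
    using D by (meson DERIV_isCont continuous_at_imp_continuous_on)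
  then have E': "(E has_real_derivative - 4 * D x) (at x)" for x
    by (intro indefinite_integral_DERIV E continuous_intros)
  have const: "f x = f 0" if "\<And>x. (f has_real_derivative 0) (at x)" for f :: "real \<Rightarrow> real" and x
    using DERIV_isconst_all[of f x 0] that by blast
  have 1: "E x * cos (2*x) + 2 * D x * sin (2*x) = E 0" for x
    using const[of "\<lambda>x. E x * cos (2*x) + 2 * D x * sin (2*x)" x]
    by (force intro!: derivative_eq_intros D E' simp: algebra_simps)
  have 2: "E x * sin (2*x) - 2 * D x * cos (2*x) = - 2 * D 0" for x
    using const[of "\<lambda>x. E x * sin (2*x) - 2 * D x * cos (2*x)" x]
    by (force intro!: derivative_eq_intros D E' simp: algebra_simps)
  have "D x = D 0 * cos (2*x) + (E 0 / 2) * sin (2*x)" for x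
  proof -
    have "2 * D x * ((sin (2*x))\<^sup>2 + (cos (2*x))\<^sup>2) = E 0 * sin (2*x) + 2 * D 0 * cos (2*x)"
    proof -
      have "2 * D x * ((sin (2*x))\<^sup>2 + (cos (2*x))\<^sup>2) =
          (E x * cos (2*x) + 2 * D x * sin (2*x)) * sin (2*x)
          - (E x * sin (2*x) - 2 * D x * cos (2*x)) * cos (2*x)"
        by algebra
      then show ?thesis by (simp only: 1 2 mult_minus_left diff_minus_eq_add)
    qed
    then show ?thesis by simp
  qed
  then show ?thesis by (rule that)
qed

section \<open>Reflection symmetries of the extension and of the velocity\<close>

lemma finite_arithmetic_progression:
  fixes p q :: real
  assumes "0 < p"
  shows "finite (range (\<lambda>n::int. q + of_int n * p) \<inter> {a..b})"
proof (rule finite_subset)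
  show "range (\<lambda>n::int. q + of_int n * p) \<inter> {a..b}
      \<subseteq> (\<lambda>n::int. q + of_int n * p) ` {\<lfloor>(a - q) / p\<rfloor>..\<lceil>(b - q) / p\<rceil>}"
  proof
    fix x assume "x \<in> range (\<lambda>n::int. q + of_int n * p) \<inter> {a..b}"
    then obtain n :: int where x: "x = q + of_int n * p" "a \<le> x" "x \<le> b"
      by auto
    have "(a - q) / p \<le> of_int n" "of_int n \<le> (b - q) / p"
      using x assms by (simp_all add: field_simps)
    then have "n \<in> {\<lfloor>(a - q) / p\<rfloor>..\<lceil>(b - q) / p\<rceil>}"
      by simp linarith
    with x(1) show "x \<in> (\<lambda>n::int. q + of_int n * p) ` {\<lfloor>(a - q) / p\<rfloor>..\<lceil>(b - q) / p\<rceil>}"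
      by blast
  qed
qed simp

text \<open>The endpoints shared by neighbouring copies of \<open>Q\<close>. There
  \<open>periodic_ext\<close> takes the value at -pi/4, so the odd reflection may fail at these
  points.\<close>

definition seams :: "real set" where
  "seams = range (\<lambda>n::int. - (pi/4) + of_int n * (pi/2))"

lemma finite_seams: "finite (seams \<inter> {a..b})"
  unfolding seams_def by (rule finite_arithmetic_progression) simp

lemma quarter_period_decomp:
  obtains n :: int and y where "x = y + of_int n * (pi/2)" "y \<in> {- (pi/4)..<pi/4}"
proof -
  define q where "q = x / (pi/2) + 1/2"
  have "of_int \<lfloor>q\<rfloor> * (pi/2) \<le> q * (pi/2)" "q * (pi/2) < (of_int \<lfloor>q\<rfloor> + 1) * (pi/2)"
    by (rule mult_right_mono mult_strict_right_mono; use pi_gt_zero in linarith)+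
  moreover have "q * (pi/2) = x + pi/4"
    by (simp add: q_def field_simps)
  ultimately have "x - of_int \<lfloor>q\<rfloor> * (pi/2) \<in> {- (pi/4)..<pi/4}"
    unfolding distrib_right mult_1 atLeastLessThan_iff by linarith
  then show ?thesis
    by (intro that[of "x - of_int \<lfloor>q\<rfloor> * (pi/2)" "\<lfloor>q\<rfloor>"]) simp
qed

text \<open>Oddness about 0 together with the period pi/2 gives oddness about every multiple of
  pi/4. The cases k = 0 and k = 1, reflection about 0 and about pi/4, are the ones used
  later.\<close>

lemma periodic_ext_reflect:
  assumes odd: "odd_on Q f" and x: "x \<notin> seams"
  shows "periodic_ext f (of_int k * (pi/2) - x) = - periodic_ext f x"
proof -
  obtain n y where x_eq: "x = y + of_int n * (pi/2)" and y: "y \<in> {- (pi/4)..<pi/4}"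
    by (rule quarter_period_decomp)
  with x have "y \<noteq> - (pi/4)" by (auto simp: seams_def)
  with y have y': "- y \<in> {- (pi/4)..<pi/4}" by auto
  have "of_int k * (pi/2) - x = - y + of_int (k - n) * (pi/2)"
    unfolding x_eq by (simp add: algebra_simps)
  then have "periodic_ext f (of_int k * (pi/2) - x) = f (- y)"
    using periodic_ext_shift[OF y'] by (simp only:)
  also have "\<dots> = - f y"
    using odd y by (auto simp: odd_on_def)
  also have "f y = periodic_ext f x"
    unfolding x_eq using periodic_ext_shift[OF y] by simp
  finally show ?thesis .
qed

text \<open>The resonant modes $\cos 2x$, $\sin 2x$ are the kernel of the operator, and the Fourier
  condition excludes exactly them; so every symmetry of $\tilde f$ passes to \<open>H\<close>.\<close>

lemma circle_velocity_reflect: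
  assumes cv: "circle_velocity f H" and c: "0 \<le> c" "c \<le> 2 * pi"
    and refl: "\<And>x. x \<notin> S \<Longrightarrow> periodic_ext f (c - x) = - periodic_ext f x"
    and S: "\<And>a b. finite (S \<inter> {a..b})"
  shows "H (c - x) = - H x"
proof -
  obtain G where per: "\<And>x. H (x + 2*pi) = H x" and HG: "\<And>x. (H has_real_derivative G x) (at x)"
    and G: "\<And>a b. a \<le> b \<Longrightarrow> ((\<lambda>x. periodic_ext f x - 4 * H x) has_integral (G b - G a)) {a..b}"
    and F: "((\<lambda>x. complex_of_real (H x) * exp (2 * \<i> * complex_of_real x)) has_integral 0) {- pi..pi}"
    using cv by (auto simp: circle_velocity_def)
  have contH: "continuous_on T H" for T
    using HG by (meson DERIV_isCont continuous_at_imp_continuous_on)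
  \<comment> \<open>\<open>E\<close> measures the failure of the symmetry. The right-hand sides
    cancel off \<open>S\<close>, so \<open>E\<close> lies in the kernel of the operator.\<close>
  define E where "E = (\<lambda>x. H x + H (c - x))"
  have DE: "(E has_real_derivative (G x - G (c - x))) (at x)" for x
  proof -
    have "((\<lambda>x. H (c - x)) has_real_derivative G (c - x) * (- 1)) (at x)"
      by (rule DERIV_chain2[OF HG]) (auto intro!: derivative_eq_intros)
    from DERIV_add[OF HG this] show ?thesis by (simp add: E_def)
  qed
  have "((\<lambda>x. - 4 * E x) has_integral ((G b - G (c - b)) - (G a - G (c - a)))) {a..b}" if "a \<le> b" for a b
  proof -
    have "((\<lambda>x. periodic_ext f (c - x) - 4 * H (c - x)) has_integral (G (c - a) - G (c - b))) {a..b}"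
      by (rule has_integral_reflect_shift) (use that in \<open>intro G, simp\<close>)
    from has_integral_add[OF G[OF that] this]
    have "((\<lambda>x. (periodic_ext f x - 4 * H x) + (periodic_ext f (c - x) - 4 * H (c - x)))
        has_integral ((G b - G (c - b)) - (G a - G (c - a)))) {a..b}"
      by (simp add: algebra_simps)
    then show ?thesis
      by (rule has_integral_spike_finite[OF S[of a b], rotated]) (use refl in \<open>auto simp: E_def\<close>)
  qed
  from harmonic_oscillator[OF DE this]
  obtain A B where E_eq: "\<And>x. E x = A * cos (2*x) + B * sin (2*x)" by metis
  have cos0: "((\<lambda>x. H x * cos (2*x)) has_integral 0) {- pi..pi}"
    using has_integral_linear[OF F bounded_linear_Re] by (simp add: o_def Re_exp)
  have sin0: "((\<lambda>x. H x * sin (2*x)) has_integral 0) {- pi..pi}"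
    using has_integral_linear[OF F bounded_linear_Im] by (simp add: o_def Im_exp)
  let ?w = "\<lambda>x. A * cos (2*x) + B * sin (2*x)"
  have w_int: "((\<lambda>x. H x * (P * cos (2*x) + R * sin (2*x))) has_integral 0) {- pi..pi}" for P R
    using has_integral_add[OF has_integral_mult_right[OF cos0, of P] has_integral_mult_right[OF sin0, of R]]
    by (simp add: algebra_simps)
  \<comment> \<open>Reflection maps a combination of cos 2x and sin 2x to another such combination,
    and periodicity brings the shifted interval back to [-pi, pi]; so the reflected velocity is
    orthogonal to the modes as well.\<close>
  have refl_int: "((\<lambda>x. H (c - x) * ?w x) has_integral 0) {- pi..pi}"
  proof -
    let ?F = "\<lambda>y. H y * ?w (c - y)"
    have F_eq: "?F = (\<lambda>y. H y * ((A * cos (2*c) + B * sin (2*c)) * cos (2*y) + (A * sin (2*c) - B * cos (2*c)) * sin (2*y)))"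
      by (simp add: fun_eq_iff right_diff_distrib cos_diff sin_diff algebra_simps)
    have contF: "continuous_on T ?F" for T
      by (intro continuous_intros contH)
    have "integral {-pi + c..-pi + c + 2*pi} ?F = integral {-pi..-pi + 2*pi} ?F"
    proof (rule integral_over_period)
      show "?F (x + 2*pi) = ?F x" for x
      proof -
        have "2 * (c - x) = 2 * (c - (x + 2*pi)) + 2*pi + 2*pi" by simp
        then show ?thesis by (simp only: per cos_periodic sin_periodic)
      qed
    qed (use c contF in auto)
    also have "\<dots> = 0"
      using w_int unfolding F_eq by (simp add: integral_unique)
    finally have "(?F has_integral 0) {-pi + c..-pi + c + 2*pi}"
      using integrable_integral[OF integrable_continuous_real[OF contF[of "{-pi + c..-pi + c + 2*pi}"]]] by simp
    then have "(?F has_integral 0) {c - pi..c - (- pi)}"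
      by (simp add: add.commute)
    from has_integral_reflect_shift[OF this] show ?thesis by simp
  qed
  \<comment> \<open>\<open>E\<close> is itself a combination of the two modes, hence orthogonal to
    itself.\<close>
  have "((\<lambda>x. E x * E x) has_integral 0) {-pi..pi}"
    using has_integral_add[OF w_int[of A B] refl_int]
    by (subst (2) E_eq) (simp add: E_def algebra_simps)
  moreover have "continuous_on {-pi..pi} E"
    using DE by (meson DERIV_isCont continuous_at_imp_continuous_on)
  ultimately have sq0: "E x * E x = 0" if "x \<in> {-pi..pi}" for x
    using has_integral_0_cbox_imp_0[of "-pi" pi "\<lambda>x. E x * E x" x] that
    by (simp add: continuous_on_mult not_le)
  have "A = 0" using sq0[of 0] E_eq[of 0] by simp
  moreover have "B = 0" using sq0[of "pi/4"] E_eq[of "pi/4"] by simp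
  ultimately show ?thesis
    using E_eq[of x] by (simp add: E_def)
qed

text \<open>The equation is paired with the homogeneous solution vanishing at the relevant endpoint:
  sin 2x on [0, x] and cos 2x on [x, pi/4]. The boundary terms there drop because H(0) = H(pi/4) =
  0. Eliminating G from the two identities gives the Green formula for H; eliminating H gives one
  for H'.\<close>

lemma circle_velocity_quarter:
  assumes odd: "odd_on Q f" and f: "continuous_on {0..pi/4} f" and cv: "circle_velocity f H"
  obtains G where "\<And>x. (H has_real_derivative G x) (at x)" "\<And>x. H (- x) = - H x" "H (pi/4) = 0"
    "\<And>x. x \<in> {0..pi/4} \<Longrightarrow>
       ((\<lambda>s. f s * sin (2 * s)) has_integral (G x * sin (2*x) - 2 * H x * cos (2*x))) {0..x}"
    "\<And>x. x \<in> {0..pi/4} \<Longrightarrow>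
       ((\<lambda>s. f s * cos (2 * s)) has_integral - (G x * cos (2*x) + 2 * H x * sin (2*x))) {x..pi/4}"
proof -
  obtain G where HG: "\<And>x. (H has_real_derivative G x) (at x)"
    and G: "\<And>a b. a \<le> b \<Longrightarrow> ((\<lambda>x. periodic_ext f x - 4 * H x) has_integral (G b - G a)) {a..b}"
    using cv by (auto simp: circle_velocity_def)
  have contH: "continuous_on T H" for T
    using HG by (meson DERIV_isCont continuous_at_imp_continuous_on)
  have refl0: "H (- x) = - H x" for x
    using circle_velocity_reflect[OF cv, of 0 seams x] periodic_ext_reflect[OF odd, of _ 0] finite_seams by simp
  have "H (pi/2 - pi/4) = - H (pi/4)"
    using circle_velocity_reflect[OF cv, of "pi/2" seams "pi/4"] periodic_ext_reflect[OF odd, of _ 1] finite_seams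
    by simp
  then have H4: "H (pi/4) = 0" by simp
  have H0: "H 0 = 0" using refl0[of 0] by simp
  have G': "(G has_real_derivative f x - 4 * H x) (at x within {0..pi/4})" if "x \<in> {0..pi/4}" for x
  proof (rule indefinite_integral_DERIV_within[OF _ _ that])
    show "continuous_on {0..pi/4} (\<lambda>x. f x - 4 * H x)"
      by (intro continuous_intros f contH)
    fix y assume y: "y \<in> {0..pi/4}"
    show "((\<lambda>x. f x - 4 * H x) has_integral (G y - G 0)) {0..y}"
    proof (rule has_integral_spike_finite[OF _ _ G])
      \<comment> \<open>At pi/4 the extension takes the value f(-pi/4), so this single point is
        excepted.\<close>
      show "f x - 4 * H x = periodic_ext f x - 4 * H x" if "x \<in> {0..y} - {pi/4}" for x
        using periodic_ext_shift[of x f 0] that y by auto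
    qed (use y in auto)
  qed
  have HG': "(H has_real_derivative G x) (at x within S)" for x S
    using HG by (rule DERIV_subset) simp
  show ?thesis
  proof (rule that[OF HG refl0 H4])
    fix x assume x: "x \<in> {0..pi/4}"
    let ?A = "\<lambda>x. G x * sin (2*x) - 2 * H x * cos (2*x)"
    let ?B = "\<lambda>x. G x * cos (2*x) + 2 * H x * sin (2*x)"
    have "((\<lambda>s. f s * sin (2 * s)) has_integral (?A x - ?A 0)) {0..x}"
    proof (rule fundamental_theorem_of_calculus)
      fix s assume s: "s \<in> {0..x}"
      have "(?A has_real_derivative f s * sin (2 * s)) (at s within {0..pi/4})"
        using s x by (auto intro!: derivative_eq_intros G' HG' simp: algebra_simps)
      then show "(?A has_vector_derivative f s * sin (2 * s)) (at s within {0..x})"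
        using x by (auto simp flip: has_real_derivative_iff_has_vector_derivative intro: DERIV_subset)
    qed (use x in auto)
    then show "((\<lambda>s. f s * sin (2 * s)) has_integral ?A x) {0..x}"
      by (simp add: H0)
    have "((\<lambda>s. f s * cos (2 * s)) has_integral (?B (pi/4) - ?B x)) {x..pi/4}"
    proof (rule fundamental_theorem_of_calculus)
      fix s assume s: "s \<in> {x..pi/4}"
      have "(?B has_real_derivative f s * cos (2 * s)) (at s within {0..pi/4})"
        using s x by (auto intro!: derivative_eq_intros G' HG' simp: algebra_simps)
      then show "(?B has_vector_derivative f s * cos (2 * s)) (at s within {x..pi/4})"
        using x by (auto simp flip: has_real_derivative_iff_has_vector_derivative intro: DERIV_subset)
    qed (use x in auto)
    then show "((\<lambda>s. f s * cos (2 * s)) has_integral - ?B x) {x..pi/4}"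
      by (simp add: H4)
  qed
qed

lemma circle_velocity_zero:
  assumes "odd_on Q f" "continuous_on {0..pi/4} f" "circle_velocity f H"
  shows "H 0 = 0" "H (pi/4) = 0"
proof -
  have "(\<forall>x. H (- x) = - H x) \<and> H (pi/4) = 0"
    by (rule circle_velocity_quarter[OF assms]) blast
  then show "H (pi/4) = 0" and "H 0 = 0"
    by (auto dest: spec[of _ 0])
qed

text \<open>Solving the two quarter identities for the derivative gives G = A sin 2x + B cos 2x with
  |A| <= b x and |B| <= b (pi/4 - x), so the variable x cancels in the sum. G is even because H is
  odd, which carries the bound to all of \<open>Q\<close>.\<close>

lemma circle_velocity_lipschitz:
  assumes odd: "odd_on Q f" and f: "continuous_on {0..pi/4} f" and cv: "circle_velocity f H"
    and bound: "\<And>x. x \<in> {0..pi/4} \<Longrightarrow> \<bar>f x\<bar> \<le> b" and xy: "x \<in> Q" "y \<in> Q"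
  shows "\<bar>H x - H y\<bar> \<le> b * (pi/4) * \<bar>x - y\<bar>"
proof -
  obtain G where HG: "\<And>x. (H has_real_derivative G x) (at x)" and H_odd: "\<And>x. H (- x) = - H x"
    and "H (pi/4) = 0"
    and A: "\<And>x. x \<in> {0..pi/4} \<Longrightarrow>
       ((\<lambda>s. f s * sin (2 * s)) has_integral (G x * sin (2*x) - 2 * H x * cos (2*x))) {0..x}"
    and B: "\<And>x. x \<in> {0..pi/4} \<Longrightarrow>
       ((\<lambda>s. f s * cos (2 * s)) has_integral - (G x * cos (2*x) + 2 * H x * sin (2*x))) {x..pi/4}"
    by (rule circle_velocity_quarter[OF odd f cv]) (rule that; blast)
  have b: "0 \<le> b" using bound[of 0] by simp
  have mult_le: "\<bar>u * v\<bar> \<le> c" if "\<bar>u\<bar> \<le> c" "\<bar>v\<bar> \<le> 1" for u v c :: real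
    using mult_mono[OF that] that by (simp add: abs_mult)
  have G_pos: "\<bar>G x\<bar> \<le> b * (pi/4)" if x: "x \<in> {0..pi/4}" for x
  proof -
    let ?A = "G x * sin (2*x) - 2 * H x * cos (2*x)"
    let ?B = "G x * cos (2*x) + 2 * H x * sin (2*x)"
    have "norm ?A \<le> b * Sigma_Algebra.measure lborel (cbox 0 x)"
      by (rule has_integral_bound[OF b]) (use A[OF x] x in \<open>auto intro!: mult_le bound\<close>)
    moreover have "norm (- ?B) \<le> b * Sigma_Algebra.measure lborel (cbox x (pi/4))"
      by (rule has_integral_bound[OF b]) (use B[OF x] x in \<open>auto intro!: mult_le bound\<close>)
    ultimately have AB: "\<bar>?A\<bar> \<le> b * x" "\<bar>?B\<bar> \<le> b * (pi/4 - x)"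
      using x by auto
    have "?A * sin (2*x) + ?B * cos (2*x) = G x * ((sin (2*x))\<^sup>2 + (cos (2*x))\<^sup>2)"
      by algebra
    then have "G x = ?A * sin (2*x) + ?B * cos (2*x)" by simp
    moreover have "\<bar>?A * sin (2*x)\<bar> \<le> b * x" "\<bar>?B * cos (2*x)\<bar> \<le> b * (pi/4 - x)"
      by (intro mult_le AB; simp)+
    ultimately have "\<bar>G x\<bar> \<le> b * x + b * (pi/4 - x)" by linarith
    then show ?thesis by (simp add: algebra_simps)
  qed
  have even: "G (- x) = G x" for x
  proof -
    have "((\<lambda>x. H (- x)) has_real_derivative - G (- x)) (at x)"
      using HG[of "- x"] by (subst (asm) DERIV_mirror) simp
    moreover have "((\<lambda>x. H (- x)) has_real_derivative - G x) (at x)"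
      unfolding H_odd by (intro DERIV_minus HG)
    ultimately show ?thesis using DERIV_unique by fastforce
  qed
  have "\<bar>G x\<bar> \<le> b * (pi/4)" if "x \<in> Q" for x
    using G_pos[of x] G_pos[of "- x"] even[of x] that by (cases "0 \<le> x") auto
  then have "norm (H x - H y) \<le> b * (pi/4) * norm (x - y)"
    by (intro field_differentiable_bound[of Q H G]) (use xy HG in \<open>auto intro: DERIV_subset\<close>)
  then show ?thesis by simp
qed

text \<open>The Green function $-\frac12\sin(2\min)\cos(2\max)$ is at most
  $-\frac18\sin 4x\,\sin 4s$, which decouples its two variables.\<close>

lemma circle_velocity_upper:
  assumes odd: "odd_on Q f" and f: "continuous_on {0..pi/4} f" and cv: "circle_velocity f H"
    and nonneg: "\<And>x. x \<in> {0..pi/4} \<Longrightarrow> 0 \<le> f x"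
    and lower: "\<And>x. x \<in> {pi/4 - d..pi/4} \<Longrightarrow> v \<le> f x" and d: "0 \<le> d" "d \<le> pi/4" and "0 \<le> v"
    and x: "x \<in> {0..pi/4}"
  shows "2 * H x \<le> - (v / 16 * (1 - cos (4*d)) * sin (4*x))"
proof -
  obtain G where HG: "\<And>x. (H has_real_derivative G x) (at x)" and H_odd: "\<And>x. H (- x) = - H x"
    and "H (pi/4) = 0"
    and A: "\<And>x. x \<in> {0..pi/4} \<Longrightarrow>
       ((\<lambda>s. f s * sin (2 * s)) has_integral (G x * sin (2*x) - 2 * H x * cos (2*x))) {0..x}"
    and B: "\<And>x. x \<in> {0..pi/4} \<Longrightarrow>
       ((\<lambda>s. f s * cos (2 * s)) has_integral - (G x * cos (2*x) + 2 * H x * sin (2*x))) {x..pi/4}"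
    by (rule circle_velocity_quarter[OF odd f cv]) (rule that; blast)
  have sc: "0 \<le> sin (2 * s)" "0 \<le> cos (2 * s)" if "s \<in> {0..pi/4}" for s
    using that by (auto intro!: sin_ge_zero cos_ge_zero)
  \<comment> \<open>Inserting the missing factor, at most 1, into each half of the Green integral
    gives both halves the same integrand \<open>k\<close>, so they join to one integral over
    [0, pi/4] that does not depend on x.\<close>
  define k where "k = (\<lambda>s. f s * sin (2 * s) * cos (2 * s))"
  have k_int: "k integrable_on {p..q}" if "0 \<le> p" "q \<le> pi/4" for p q
    unfolding k_def by (intro integrable_continuous_real continuous_intros continuous_on_subset[OF f]) (use that in auto)
  let ?A = "G x * sin (2*x) - 2 * H x * cos (2*x)"
  let ?B = "G x * cos (2*x) + 2 * H x * sin (2*x)"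
  have "sin (2*x) * integral {0..x} k \<le> ?A"
  proof (rule has_integral_le[OF _ A[OF x]])
    show "((\<lambda>s. sin (2*x) * k s) has_integral sin (2*x) * integral {0..x} k) {0..x}"
      by (intro has_integral_mult_right integrable_integral k_int) (use x in auto)
    fix s assume "s \<in> {0..x}"
    then have s: "s \<in> {0..pi/4}" using x by auto
    have "(f s * sin (2 * s)) * (sin (2*x) * cos (2 * s)) \<le> (f s * sin (2 * s)) * 1"
      using sc[OF s] sc[OF x] nonneg[OF s] by (intro mult_left_mono mult_le_one) auto
    then show "sin (2*x) * k s \<le> f s * sin (2 * s)"
      by (simp add: k_def algebra_simps)
  qed
  moreover have "cos (2*x) * integral {x..pi/4} k \<le> - ?B"
  proof (rule has_integral_le[OF _ B[OF x]])
    show "((\<lambda>s. cos (2*x) * k s) has_integral cos (2*x) * integral {x..pi/4} k) {x..pi/4}"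
      by (intro has_integral_mult_right integrable_integral k_int) (use x in auto)
    fix s assume "s \<in> {x..pi/4}"
    then have s: "s \<in> {0..pi/4}" using x by auto
    have "(f s * cos (2 * s)) * (cos (2*x) * sin (2 * s)) \<le> (f s * cos (2 * s)) * 1"
      using sc[OF s] sc[OF x] nonneg[OF s] by (intro mult_left_mono mult_le_one) auto
    then show "cos (2*x) * k s \<le> f s * cos (2 * s)"
      by (simp add: k_def algebra_simps)
  qed
  \<comment> \<open>With these weights the terms in G cancel and only -2H remains.\<close>
  ultimately have "sin (2*x) * integral {0..x} k * cos (2*x) + cos (2*x) * integral {x..pi/4} k * sin (2*x)
      \<le> ?A * cos (2*x) + (- ?B) * sin (2*x)"
    using sc[OF x] by (intro add_mono mult_right_mono)
  also have "\<dots> = - 2 * H x * ((sin (2*x))\<^sup>2 + (cos (2*x))\<^sup>2)"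
    by algebra
  also have "\<dots> = - 2 * H x" by simp
  also have "sin (2*x) * integral {0..x} k * cos (2*x) + cos (2*x) * integral {x..pi/4} k * sin (2*x)
      = sin (2*x) * cos (2*x) * (integral {0..x} k + integral {x..pi/4} k)"
    by (simp add: algebra_simps)
  also have "integral {0..x} k + integral {x..pi/4} k = integral {0..pi/4} k"
    using x by (intro Henstock_Kurzweil_Integration.integral_combine k_int) auto
  also have "sin (2*x) * cos (2*x) = sin (4*x) / 2"
    using sin_double[of "2*x"] by simp
  finally have main: "sin (4*x) / 2 * integral {0..pi/4} k \<le> - 2 * H x" .
  have sin4: "0 \<le> sin (4 * s)" if "s \<in> {0..pi/4}" for s
    using that by (auto intro!: sin_ge_zero)
  have k_eq: "k s = f s * (sin (4 * s) / 2)" for s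
    using sin_double[of "2 * s"] by (simp add: k_def)
  \<comment> \<open>The left side is the integral of v sin(4s)/2 over the last stretch of length d;
    the remaining factor sin(4x)/2 turns 1/8 into 1/16.\<close>
  have "v / 8 * (1 - cos (4*d)) \<le> integral {pi/4 - d..pi/4} k"
  proof (rule has_integral_le[OF _ integrable_integral[OF k_int]])
    let ?P = "\<lambda>s. - (v / 8) * cos (4 * s)"
    have "((\<lambda>s. v * (sin (4 * s) / 2)) has_integral (?P (pi/4) - ?P (pi/4 - d))) {pi/4 - d..pi/4}"
      by (rule fundamental_theorem_of_calculus)
         (use d in \<open>auto simp flip: has_real_derivative_iff_has_vector_derivative intro!: derivative_eq_intros\<close>)
    then show "((\<lambda>s. v * (sin (4 * s) / 2)) has_integral v / 8 * (1 - cos (4*d))) {pi/4 - d..pi/4}"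
      by (simp add: right_diff_distrib cos_diff algebra_simps)
    show "v * (sin (4 * s) / 2) \<le> k s" if "s \<in> {pi/4 - d..pi/4}" for s
      unfolding k_eq using lower[OF that] sin4[of s] that d by (intro mult_right_mono) auto
  qed (use d in auto)
  also have "\<dots> \<le> integral {0..pi/4} k"
    using d nonneg sin4 by (intro integral_subset_le k_int) (auto simp: k_eq)
  finally have "sin (4*x) / 2 * (v / 8 * (1 - cos (4*d))) \<le> sin (4*x) / 2 * integral {0..pi/4} k"
    using sin4[OF x] by (intro mult_left_mono) auto
  with main show ?thesis by (simp add: algebra_simps)
qed

section \<open>The flow on the quarter interval\<close>

text \<open>The squared gap weighted by exp(-2Kt) is nonincreasing; squaring avoids differentiating
  an absolute value where the curves meet.\<close>

lemma gronwall_gap: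
  fixes p q p' q' :: "real \<Rightarrow> real"
  assumes "s \<le> T"
    and p: "\<And>t. t \<in> {s..T} \<Longrightarrow> (p has_real_derivative p' t) (at t within {s..T})"
    and q: "\<And>t. t \<in> {s..T} \<Longrightarrow> (q has_real_derivative q' t) (at t within {s..T})"
    and K: "\<And>t. t \<in> {s..T} \<Longrightarrow> \<bar>p' t - q' t\<bar> \<le> K * \<bar>p t - q t\<bar>"
  shows "\<bar>p T - q T\<bar> \<le> exp (K * (T - s)) * \<bar>p s - q s\<bar>"
proof -
  define Z where "Z = (\<lambda>t. exp (- 2 * K * t) * (p t - q t)\<^sup>2)"
  define Z' where "Z' = (\<lambda>t. exp (- 2 * K * t) * (2 * ((p t - q t) * (p' t - q' t)) - 2 * K * (p t - q t)\<^sup>2))"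
  have Z: "(Z has_real_derivative Z' t) (at t within {s..T})" if "t \<in> {s..T}" for t
    unfolding Z_def Z'_def using p[OF that] q[OF that]
    by (auto intro!: derivative_eq_intros simp: algebra_simps power2_eq_square)
  have Z'_le: "Z' t \<le> 0" if "t \<in> {s..T}" for t
  proof -
    have "(p t - q t) * (p' t - q' t) \<le> \<bar>p t - q t\<bar> * \<bar>p' t - q' t\<bar>"
      by (metis abs_ge_self abs_mult)
    also have "\<dots> \<le> \<bar>p t - q t\<bar> * (K * \<bar>p t - q t\<bar>)"
      using K[OF that] by (intro mult_left_mono) auto
    also have "\<dots> = K * (p t - q t)\<^sup>2"
      by (simp add: power2_eq_square)
    finally show ?thesis
      by (simp add: Z'_def mult_le_0_iff)
  qed
  have "Z T \<le> Z s"
  proof (rule DERIV_nonpos_imp_decreasing_open[OF \<open>s \<le> T\<close>])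
    fix x assume x: "s < x" "x < T"
    then have "(Z has_real_derivative Z' x) (at x)"
      using Z[of x] by (simp add: at_within_Icc_at)
    then show "\<exists>y. (Z has_real_derivative y) (at x) \<and> y \<le> 0"
      using Z'_le[of x] x by auto
  next
    show "continuous_on {s..T} Z"
      using Z by (meson DERIV_continuous_on)
  qed
  then have "exp (2 * K * T) * Z T \<le> exp (2 * K * T) * Z s"
    by simp
  also have "exp (2 * K * T) * Z T = (p T - q T)\<^sup>2"
    by (simp add: Z_def mult_exp_exp flip: mult.assoc)
  also have "exp (2 * K * T) * Z s = exp (2 * K * T - 2 * K * s) * (p s - q s)\<^sup>2"
    by (simp add: Z_def mult_exp_exp flip: mult.assoc)
  also have "exp (2 * K * T - 2 * K * s) = (exp (K * (T - s)))\<^sup>2"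
    by (simp add: power2_eq_square mult_exp_exp algebra_simps)
  finally have "\<bar>p T - q T\<bar>\<^sup>2 \<le> (exp (K * (T - s)) * \<bar>p s - q s\<bar>)\<^sup>2"
    by (simp add: power_mult_distrib)
  then show ?thesis
    by (rule power2_le_imp_le) simp
qed

lemma le_tan:
  fixes x :: real
  assumes "0 \<le> x" "x < pi/2"
  shows "x \<le> tan x"
proof -
  have c: "0 < cos y" if "0 \<le> y" "y \<le> x" for y
    using that assms by (intro cos_gt_zero_pi) auto
  have "tan 0 - 0 \<le> tan x - x"
  proof (rule DERIV_nonneg_imp_nondecreasing[OF assms(1)])
    fix y assume y: "0 \<le> y" "y \<le> x"
    have "((\<lambda>x. tan x - x) has_real_derivative inverse ((cos y)\<^sup>2) - 1) (at y)"
      using c[OF y] by (auto intro!: derivative_eq_intros)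
    moreover have "(cos y)\<^sup>2 \<le> 1"
      by (simp add: abs_square_le_1)
    then have "1 \<le> inverse ((cos y)\<^sup>2)"
      using c[OF y] by (intro one_le_inverse) auto
    ultimately show "\<exists>D. ((\<lambda>x. tan x - x) has_real_derivative D) (at y) \<and> 0 \<le> D"
      by force
  qed
  then show ?thesis by simp
qed

text \<open>\<open>v\<close> and \<open>d\<close> stand for the lower bound near pi/4 and the width
  on which it holds initially; they become h0(pi/4)/2 and h0(pi/4)/(2M). The bound in
  \<open>bounded\<close> may depend on T: it only feeds the Lipschitz constants behind uniqueness
  and continuity of the flow, never the decay rate.\<close>

locale odd_flow =
  fixes h0 :: "real \<Rightarrow> real" and h H \<phi> :: "real \<Rightarrow> real \<Rightarrow> real" and v d :: real
  assumes odd: "0 \<le> t \<Longrightarrow> odd_on Q (h t)"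
    and cont: "0 \<le> t \<Longrightarrow> continuous_on {0..pi/4} (h t)"
    and bounded: "\<exists>B. \<forall>t\<in>{0..T}. \<forall>x\<in>{0..pi/4}. \<bar>h t x\<bar> \<le> B"
    and velocity: "0 \<le> t \<Longrightarrow> circle_velocity (h t) (H t)"
    and flow_init: "\<theta> \<in> Q \<Longrightarrow> \<phi> 0 \<theta> = \<theta>"
    and flow_in_Q: "0 \<le> t \<Longrightarrow> \<theta> \<in> Q \<Longrightarrow> \<phi> t \<theta> \<in> Q"
    and flow_ode: "0 \<le> t \<Longrightarrow> \<theta> \<in> Q \<Longrightarrow>
      ((\<lambda>s. \<phi> s \<theta>) has_real_derivative 2 * H t (\<phi> t \<theta>)) (at t within {0..})"
    and transport: "0 \<le> t \<Longrightarrow> \<theta> \<in> Q \<Longrightarrow> h t (\<phi> t \<theta>) = h0 \<theta>"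
    and nonneg: "\<theta> \<in> {0..pi/4} \<Longrightarrow> 0 \<le> h0 \<theta>"
    and lower: "\<theta> \<in> {pi/4 - d..pi/4} \<Longrightarrow> v \<le> h0 \<theta>"
    and d: "0 < d" "d < pi/4" and v: "0 < v"
begin

definition rate :: real where
  "rate = v / 16 * (1 - cos (4 * d))"

lemma rate_pos: "0 < rate"
proof -
  have "cos (4 * d) < cos 0"
    using d by (intro cos_monotone_0_pi) auto
  then show ?thesis using v by (simp add: rate_def)
qed

lemma velocity_zero:
  assumes "0 \<le> t"
  shows "H t 0 = 0" "H t (pi/4) = 0"
  using circle_velocity_zero[OF odd[OF assms] cont[OF assms] velocity[OF assms]] by blast+

text \<open>Stated for arbitrary trajectories, so that a constant one at a zero of the velocity can
  be compared with the flow.\<close>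

lemma flow_gap:
  assumes B: "\<forall>t\<in>{0..T}. \<forall>x\<in>{0..pi/4}. \<bar>h t x\<bar> \<le> B" and s: "0 \<le> s" "s \<le> T"
    and p: "\<And>t. t \<in> {s..T} \<Longrightarrow> p t \<in> Q \<and> (p has_real_derivative 2 * H t (p t)) (at t within {0..})"
    and q: "\<And>t. t \<in> {s..T} \<Longrightarrow> q t \<in> Q \<and> (q has_real_derivative 2 * H t (q t)) (at t within {0..})"
  shows "\<bar>p T - q T\<bar> \<le> exp (B * (pi/2) * (T - s)) * \<bar>p s - q s\<bar>"
proof (rule gronwall_gap[OF s(2)])
  fix t assume t: "t \<in> {s..T}"
  show "(p has_real_derivative 2 * H t (p t)) (at t within {s..T})"
    "(q has_real_derivative 2 * H t (q t)) (at t within {s..T})"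
    using p[OF t] q[OF t] s by (auto intro: DERIV_subset)
  have "\<bar>H t (p t) - H t (q t)\<bar> \<le> B * (pi/4) * \<bar>p t - q t\<bar>"
    by (rule circle_velocity_lipschitz[OF odd cont velocity]) (use t s p[OF t] q[OF t] B in auto)
  then show "\<bar>2 * H t (p t) - 2 * H t (q t)\<bar> \<le> B * (pi/2) * \<bar>p t - q t\<bar>"
    unfolding right_diff_distrib[symmetric] abs_mult by simp
qed

lemma flow_fixes:
  assumes "0 \<le> s" "s \<le> t" "\<theta> \<in> Q" and c: "c \<in> Q" "\<And>t. 0 \<le> t \<Longrightarrow> H t c = 0" and "\<phi> s \<theta> = c"
  shows "\<phi> t \<theta> = c"
proof -
  obtain B where B: "\<forall>r\<in>{0..t}. \<forall>x\<in>{0..pi/4}. \<bar>h r x\<bar> \<le> B"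
    using bounded[of t] by blast
  have "\<bar>\<phi> t \<theta> - c\<bar> \<le> exp (B * (pi/2) * (t - s)) * \<bar>\<phi> s \<theta> - c\<bar>"
  proof (rule flow_gap[OF B, of s "\<lambda>t. \<phi> t \<theta>" "\<lambda>t. c"])
    fix r assume r: "r \<in> {s..t}"
    show "\<phi> r \<theta> \<in> Q \<and> ((\<lambda>t. \<phi> t \<theta>) has_real_derivative 2 * H r (\<phi> r \<theta>)) (at r within {0..})"
      using r assms flow_in_Q[of r \<theta>] flow_ode[of r \<theta>] by auto
    show "c \<in> Q \<and> ((\<lambda>t. c) has_real_derivative 2 * H r c) (at r within {0..})"
      using r assms by auto
  qed (use assms in auto)
  then show ?thesis using assms by simp
qed

lemma flow_0:
  assumes "0 \<le> t"
  shows "\<phi> t 0 = 0"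
  using assms velocity_zero(1) flow_init[of 0] by (intro flow_fixes[of 0 t 0 0]) simp_all

lemma flow_quarter:
  assumes "0 \<le> t"
  shows "\<phi> t (pi/4) = pi/4"
  using assms velocity_zero(2) flow_init[of "pi/4"] by (intro flow_fixes[of 0 t "pi/4" "pi/4"]) simp_all

lemma continuous_on_flow:
  assumes "0 \<le> t"
  shows "continuous_on Q (\<phi> t)"
proof -
  obtain B where B: "\<forall>r\<in>{0..t}. \<forall>x\<in>{0..pi/4}. \<bar>h r x\<bar> \<le> B"
    using bounded[of t] by blast
  have "(exp (B * (pi/2) * (t - 0)))-lipschitz_on Q (\<phi> t)"
  proof (rule lipschitz_onI)
    fix x y assume xy: "x \<in> Q" "y \<in> Q"
    have "\<bar>\<phi> t x - \<phi> t y\<bar> \<le> exp (B * (pi/2) * (t - 0)) * \<bar>\<phi> 0 x - \<phi> 0 y\<bar>"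
      by (rule flow_gap[OF B, of 0 "\<lambda>t. \<phi> t x" "\<lambda>t. \<phi> t y"])
         (use assms flow_in_Q[OF _ xy(1)] flow_in_Q[OF _ xy(2)] flow_ode[OF _ xy(1)] flow_ode[OF _ xy(2)] in auto)
    then show "dist (\<phi> t x) (\<phi> t y) \<le> exp (B * (pi/2) * (t - 0)) * dist x y"
      by (simp only: flow_init xy dist_real_def)
  qed simp
  then show ?thesis by (rule lipschitz_on_continuous_on)
qed

text \<open>The endpoints stay fixed and the flow is continuous in the label, so the intermediate
  value theorem finds a label for every point. This replaces an inverse flow.\<close>

lemma flow_surj:
  assumes "0 \<le> t" "y \<in> {0..pi/4}"
  obtains \<theta> where "\<theta> \<in> {0..pi/4}" "\<phi> t \<theta> = y"
proof -
  have "continuous_on {0..pi/4} (\<phi> t)"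
    by (rule continuous_on_subset[OF continuous_on_flow[OF assms(1)]]) auto
  then have "\<exists>\<theta>\<ge>0. \<theta> \<le> pi/4 \<and> \<phi> t \<theta> = y"
    using assms by (intro IVT') (auto simp: flow_0 flow_quarter)
  then show ?thesis using that by auto
qed

text \<open>A trajectory that became negative would first pass through 0, where uniqueness holds it
  forever.\<close>

lemma flow_nonneg:
  assumes "0 \<le> t" "\<theta> \<in> {0..pi/4}"
  shows "0 \<le> \<phi> t \<theta>"
proof (rule ccontr)
  assume neg: "\<not> 0 \<le> \<phi> t \<theta>"
  have "continuous_on {0..} (\<lambda>s. \<phi> s \<theta>)"
    using flow_ode[of _ \<theta>] assms by (intro DERIV_continuous_on) auto
  then have "continuous_on {0..t} (\<lambda>s. \<phi> s \<theta>)"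
    by (rule continuous_on_subset) auto
  then have "\<exists>s\<ge>0. s \<le> t \<and> \<phi> s \<theta> = 0"
    using assms neg by (intro IVT2') (auto simp: flow_init)
  then obtain s where s: "0 \<le> s" "s \<le> t" "\<phi> s \<theta> = 0" by auto
  have "\<phi> t \<theta> = 0"
    by (rule flow_fixes[of s]) (use s assms velocity_zero in auto)
  with neg show False by simp
qed

section \<open>Motion towards 0, first by sign and then with a rate\<close>

lemma transported_nonneg:
  assumes "0 \<le> t" "y \<in> {0..pi/4}"
  shows "0 \<le> h t y"
proof -
  obtain \<theta> where "\<theta> \<in> {0..pi/4}" "\<phi> t \<theta> = y" using flow_surj[OF assms] by blast
  then show ?thesis using transport[of t \<theta>] nonneg[of \<theta>] assms by auto
qed

text \<open>The upper bound with v = 0, which needs only h >= 0. The positive \<open>v\<close> is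
  not yet available: its survival in \<open>transported_lower\<close> rests on this sign.\<close>

lemma velocity_nonpos:
  assumes "0 \<le> t" "x \<in> {0..pi/4}"
  shows "H t x \<le> 0"
proof -
  have "2 * H t x \<le> - (0 / 16 * (1 - cos (4 * d)) * sin (4 * x))"
    by (rule circle_velocity_upper[OF odd cont velocity]) (use assms d transported_nonneg in auto)
  then show ?thesis by simp
qed

lemma flow_le:
  assumes "0 \<le> t" "\<theta> \<in> {0..pi/4}"
  shows "\<phi> t \<theta> \<in> {0..\<theta>}"
proof -
  have loc: "\<phi> s \<theta> \<in> {0..pi/4}" if "0 \<le> s" for s
    using that assms flow_nonneg[of s \<theta>] flow_in_Q[of s \<theta>] by auto
  have "\<phi> t \<theta> \<le> \<phi> 0 \<theta>"
  proof (rule DERIV_nonpos_imp_decreasing_open[OF assms(1)])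
    fix s assume s: "0 < s" "s < t"
    then have "((\<lambda>s. \<phi> s \<theta>) has_real_derivative 2 * H s (\<phi> s \<theta>)) (at s)"
      using flow_ode[of s \<theta>] assms by (simp add: at_within_interior[of s "{0..}"])
    moreover have "2 * H s (\<phi> s \<theta>) \<le> 0"
      using velocity_nonpos[of s] loc[of s] s by simp
    ultimately show "\<exists>y. ((\<lambda>s. \<phi> s \<theta>) has_real_derivative y) (at s) \<and> y \<le> 0" by blast
  next
    have "continuous_on {0..} (\<lambda>s. \<phi> s \<theta>)"
      using flow_ode[of _ \<theta>] assms by (intro DERIV_continuous_on) auto
    then show "continuous_on {0..t} (\<lambda>s. \<phi> s \<theta>)"
      by (rule continuous_on_subset) auto
  qed
  then show ?thesis
    using flow_nonneg[OF assms] assms by (simp add: flow_init)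
qed

text \<open>Particles only move towards \<open>0\<close>, so what is carried into a neighbourhood of $\pi/4$ was
  there at time \<open>0\<close>.\<close>

lemma transported_lower:
  assumes "0 \<le> t" "y \<in> {pi/4 - d..pi/4}"
  shows "v \<le> h t y"
proof -
  have "y \<in> {0..pi/4}" using assms d by auto
  from flow_surj[OF assms(1) this] obtain \<theta> where \<theta>: "\<theta> \<in> {0..pi/4}" "\<phi> t \<theta> = y" by blast
  then have "y \<le> \<theta>" using flow_le[of t \<theta>] assms by auto
  with \<theta> show ?thesis using transport[of t \<theta>] lower[of \<theta>] assms by auto
qed

lemma velocity_upper:
  assumes "0 \<le> t" "x \<in> {0..pi/4}"
  shows "2 * H t x \<le> - (rate * sin (4 * x))"
  unfolding rate_def
  using assms d v by (intro circle_velocity_upper[OF odd[OF assms(1)] cont[OF assms(1)] velocity[OF assms(1)]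
      transported_nonneg[OF assms(1)] transported_lower[OF assms(1)]]) simp_all

text \<open>Since sin 4x = 2 sin 2x cos 2x, the velocity bound turns into (tan 2x)' <= -4 kappa tan
  2x, so \<open>W\<close> is nonincreasing. The fixed label pi/4, the pole of tan 2x, is
  excluded.\<close>

lemma tan_flow_decay:
  assumes "0 \<le> t" "\<theta> \<in> {0..<pi/4}"
  shows "tan (2 * \<phi> t \<theta>) \<le> exp (- 4 * rate * t) * tan (2 * \<theta>)"
proof -
  have loc: "\<phi> s \<theta> \<in> {0..<pi/4}" if "0 \<le> s" for s
    using flow_le[of s \<theta>] that assms by auto
  have cos_pos: "0 < cos (2 * \<phi> s \<theta>)" if "0 \<le> s" for s
    using loc[OF that] by (intro cos_gt_zero_pi) auto
  define W where "W = (\<lambda>s. exp (4 * rate * s) * tan (2 * \<phi> s \<theta>))"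
  define W' where "W' = (\<lambda>s. exp (4 * rate * s) *
    (4 * rate * tan (2 * \<phi> s \<theta>) + 2 * (2 * H s (\<phi> s \<theta>)) * inverse ((cos (2 * \<phi> s \<theta>))\<^sup>2)))"
  have W: "(W has_real_derivative W' s) (at s within {0..})" if "0 \<le> s" for s
    unfolding W_def W'_def
    using that flow_ode[of s \<theta>] assms cos_pos[OF that]
    by (auto intro!: derivative_eq_intros simp: algebra_simps)
  have W'_le: "W' s \<le> 0" if "0 \<le> s" for s
  proof -
    let ?x = "\<phi> s \<theta>"
    have "2 * (2 * H s ?x) * inverse ((cos (2 * ?x))\<^sup>2)
        \<le> 2 * (- (rate * sin (4 * ?x))) * inverse ((cos (2 * ?x))\<^sup>2)"
      using velocity_upper[of s ?x] loc[OF that] that by (intro mult_right_mono mult_left_mono) auto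
    also have "sin (4 * ?x) = 2 * sin (2 * ?x) * cos (2 * ?x)"
      using sin_double[of "2 * ?x"] by simp
    also have "2 * (- (rate * (2 * sin (2 * ?x) * cos (2 * ?x)))) * inverse ((cos (2 * ?x))\<^sup>2)
        = - 4 * rate * tan (2 * ?x)"
      using cos_pos[OF that] by (simp add: tan_def field_simps power2_eq_square)
    finally show ?thesis
      by (simp add: W'_def mult_le_0_iff)
  qed
  have "W t \<le> W 0"
  proof (rule DERIV_nonpos_imp_decreasing_open[OF assms(1)])
    fix s assume s: "0 < s" "s < t"
    then have "(W has_real_derivative W' s) (at s)"
      using W[of s] by (simp add: at_within_interior[of s "{0..}"])
    then show "\<exists>y. (W has_real_derivative y) (at s) \<and> y \<le> 0"
      using W'_le[of s] s by auto
  next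
    have "continuous_on {0..} W"
      using W by (intro DERIV_continuous_on) auto
    then show "continuous_on {0..t} W"
      by (rule continuous_on_subset) auto
  qed
  then have "exp (- 4 * rate * t) * W t \<le> exp (- 4 * rate * t) * W 0"
    by simp
  then show ?thesis
    using assms by (simp add: W_def flow_init flip: exp_add mult.assoc)
qed

text \<open>Read backwards, the decay forces tan 2\<theta> >= exp(4 kappa t) tan 2y for the label
  \<theta> of the particle at y. Its distance to pi/4 is controlled through the complementary angle,
  as pi/2 - 2\<theta> <= tan(pi/2 - 2\<theta>) = 1/tan 2\<theta>. The constant blows up as y tends
  to 0, so the convergence obtained is pointwise only.\<close>

lemma transported_close:
  assumes "0 \<le> t" "y \<in> {0<..<pi/4}" and lip: "L-lipschitz_on {0..pi/4} h0"
  shows "\<bar>h t y - h0 (pi/4)\<bar> \<le> L / (2 * tan (2 * y)) * exp (- 4 * rate * t)"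
proof -
  have "y \<in> {0..pi/4}" using assms by auto
  from flow_surj[OF assms(1) this] obtain \<theta> where \<theta>: "\<theta> \<in> {0..pi/4}" "\<phi> t \<theta> = y" by blast
  have "\<theta> \<noteq> pi/4"
  proof
    assume "\<theta> = pi/4"
    with \<theta>(2) have "y = pi/4" using flow_quarter[OF assms(1)] by simp
    with assms(2) show False by simp
  qed
  with \<theta> have \<theta>': "\<theta> \<in> {0..<pi/4}" by auto
  have "y \<le> \<theta>" using flow_le[of t \<theta>] \<theta> assms by auto
  have y_pos: "0 < tan (2 * y)" and \<theta>_pos: "0 < tan (2 * \<theta>)"
    using assms \<theta>' \<open>y \<le> \<theta>\<close> by (auto intro!: tan_gt_zero)
  have "tan (2 * y) \<le> exp (- 4 * rate * t) * tan (2 * \<theta>)"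
    using tan_flow_decay[OF assms(1) \<theta>'] \<theta> by simp
  then have "inverse (tan (2 * \<theta>)) \<le> exp (- 4 * rate * t) / tan (2 * y)"
    using y_pos \<theta>_pos by (simp add: field_simps)
  moreover have "pi/2 - 2 * \<theta> \<le> tan (pi/2 - 2 * \<theta>)"
    using \<theta>' \<open>y \<le> \<theta>\<close> assms by (intro le_tan) auto
  then have "pi/2 - 2 * \<theta> \<le> inverse (tan (2 * \<theta>))"
    by (simp add: tan_cot)
  ultimately have gap: "pi/4 - \<theta> \<le> exp (- 4 * rate * t) / (2 * tan (2 * y))"
    by simp
  have "dist (h0 \<theta>) (h0 (pi/4)) \<le> L * dist \<theta> (pi/4)"
    using \<theta> by (intro lipschitz_onD[OF lip]) auto
  also have "\<dots> \<le> L * (exp (- 4 * rate * t) / (2 * tan (2 * y)))"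
    using gap \<theta> lipschitz_on_nonneg[OF lip] by (intro mult_left_mono) (auto simp: dist_real_def)
  finally show ?thesis
    using transport[of t \<theta>] \<theta> assms by (simp add: dist_real_def)
qed

lemma transported_tendsto:
  assumes "y \<in> {0<..<pi/4}" and lip: "L-lipschitz_on {0..pi/4} h0"
  shows "((\<lambda>t. h t y) \<longlongrightarrow> h0 (pi/4)) at_top"
proof -
  have "((\<lambda>t. L / (2 * tan (2 * y)) * exp (- 4 * rate * t)) \<longlongrightarrow> L / (2 * tan (2 * y)) * 0) at_top"
  proof (intro tendsto_mult tendsto_const filterlim_compose[OF exp_at_bot])
    have "filterlim (\<lambda>t. (- 4 * rate) * t) at_bot at_top"
      using rate_pos by (intro filterlim_tendsto_neg_mult_at_bot[OF tendsto_const]) (auto simp: filterlim_ident)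
    then show "filterlim (\<lambda>t. - 4 * rate * t) at_bot at_top" .
  qed
  then have lim: "((\<lambda>t. L / (2 * tan (2 * y)) * exp (- 4 * rate * t)) \<longlongrightarrow> 0) at_top"
    by (simp only: mult_zero_right)
  have "\<forall>\<^sub>F t in at_top. norm (h t y - h0 (pi/4)) \<le> L / (2 * tan (2 * y)) * exp (- 4 * rate * t)"
    using eventually_ge_at_top[of 0] transported_close[OF _ assms]
    by (auto elim!: eventually_mono simp only: real_norm_def)
  from Lim_null_comparison[OF this lim] show ?thesis
    by (rule LIM_zero_cancel)
qed

lemma transported_bound:
  assumes "0 \<le> t" "y \<in> {0..pi/4}" and "\<And>\<theta>. \<theta> \<in> {0..pi/4} \<Longrightarrow> \<bar>h0 \<theta>\<bar> \<le> B"
  shows "\<bar>h t y\<bar> \<le> B"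
proof -
  obtain \<theta> where "\<theta> \<in> {0..pi/4}" "\<phi> t \<theta> = y" using flow_surj[OF assms(1,2)] by blast
  then show ?thesis using transport[of t \<theta>] assms by auto
qed

text \<open>The difference quotient between 0 and the particle labelled pi/4 - d is at least v/x,
  with 2x <= tan 2x <= exp(-4 kappa t) cot 2d; this is the source of the factor 2 v tan 2d.\<close>

lemma gradient_growth:
  assumes "0 \<le> t" and lip: "N-lipschitz_on {0..pi/4} (h t)"
  shows "2 * v * tan (2 * d) * exp (4 * rate * t) \<le> N"
proof -
  define x where "x = \<phi> t (pi/4 - d)"
  have x: "x \<in> {0..pi/4 - d}"
    unfolding x_def using d assms by (intro flow_le) auto
  have "h t 0 = 0"
    using odd[OF assms(1), unfolded odd_on_def, rule_format, of 0] by simp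
  moreover have "v \<le> h t x"
    unfolding x_def using transport[of t "pi/4 - d"] lower[of "pi/4 - d"] assms d by auto
  moreover have "dist (h t x) (h t 0) \<le> N * dist x 0"
    using x d by (intro lipschitz_onD[OF lip]) auto
  ultimately have vN: "v \<le> N * x"
    using x by (simp add: dist_real_def)
  have "2 * x \<le> tan (2 * x)"
    using x d by (intro le_tan) auto
  also have "\<dots> \<le> exp (- 4 * rate * t) * tan (2 * (pi/4 - d))"
    unfolding x_def using d assms by (intro tan_flow_decay) auto
  also have "tan (2 * (pi/4 - d)) = inverse (tan (2 * d))"
    by (simp add: right_diff_distrib tan_cot)
  finally have "2 * x \<le> exp (- 4 * rate * t) * inverse (tan (2 * d))" .
  then have "N * (2 * x) \<le> N * (exp (- 4 * rate * t) * inverse (tan (2 * d)))"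
    using lipschitz_on_nonneg[OF lip] by (intro mult_left_mono)
  with vN have le: "2 * v \<le> N * exp (- 4 * rate * t) * inverse (tan (2 * d))"
    by simp
  have tan_pos: "0 < tan (2 * d)"
    using d by (intro tan_gt_zero) auto
  have "2 * v * (tan (2 * d) * exp (4 * rate * t))
      \<le> N * exp (- 4 * rate * t) * inverse (tan (2 * d)) * (tan (2 * d) * exp (4 * rate * t))"
    using le tan_pos by (intro mult_right_mono) auto
  also have "\<dots> = N"
    using tan_pos by (simp add: field_simps exp_minus)
  finally show ?thesis by (simp add: mult.assoc)
qed

end

section \<open>The stationary step\<close>

text \<open>On [0, pi/4] this is (a/4)(1 - cos 2x - sin 2x), the solution of 4H + H'' = a vanishing
  at both ends, multiplied and divided by 1 + cos 2x + sin 2x. In this form absolute values in the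
  denominator and the sign of the numerator cover all quarters at once.\<close>

definition step_velocity :: "real \<Rightarrow> real \<Rightarrow> real" where
  "step_velocity a x = - (a/2) * (sin (2*x) * cos (2*x)) / (1 + \<bar>cos (2*x)\<bar> + \<bar>sin (2*x)\<bar>)"

definition step_velocity_deriv :: "real \<Rightarrow> real \<Rightarrow> real" where
  "step_velocity_deriv a x = (a/2) * (\<bar>sin (2*x)\<bar> - \<bar>cos (2*x)\<bar>)"

text \<open>The multiples of pi/4, where the extended step jumps and an absolute value in the
  velocity is not differentiable.\<close>

definition kinks :: "real set" where
  "kinks = {x. sin (2*x) * cos (2*x) = 0}"

lemma finite_kinks: "finite (kinks \<inter> {a..b})"
proof (rule finite_subset)
  show "kinks \<inter> {a..b} \<subseteq> range (\<lambda>n::int. 0 + of_int n * (pi/4)) \<inter> {a..b}"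
  proof
    fix x assume x: "x \<in> kinks \<inter> {a..b}"
    then have "sin (4*x) = 0"
      using sin_double[of "2*x"] by (auto simp: kinks_def)
    then obtain n :: int where "4 * x = of_int n * pi"
      by (auto simp: sin_zero_iff_int2)
    then have "x = 0 + of_int n * (pi/4)" by simp
    with x show "x \<in> range (\<lambda>n::int. 0 + of_int n * (pi/4)) \<inter> {a..b}" by blast
  qed
qed (rule finite_arithmetic_progression, simp)

lemma DERIV_abs:
  fixes f :: "real \<Rightarrow> real"
  assumes "(f has_real_derivative D) (at x)" "f x \<noteq> 0"
  shows "((\<lambda>x. \<bar>f x\<bar>) has_real_derivative sgn (f x) * D) (at x)"
proof -
  have "((\<lambda>y::real. \<bar>y\<bar>) has_real_derivative sgn (f x)) (at (f x))"
    using has_derivative_norm[OF assms(2)]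
    by (simp add: has_field_derivative_def real_norm_def[abs_def] mult.commute[of _ "sgn (f x)"] inner_real_def)
  from DERIV_chain2[OF this assms(1)] show ?thesis .
qed

text \<open>Off the kinks the absolute values are \<sigma> s and \<tau> c with signs \<sigma>,
  \<tau>, so both equations reduce to polynomial identities modulo \<sigma>^2 = \<tau>^2 = 1 and s^2
  + c^2 = 1.\<close>

lemma step_velocity_ODE:
  assumes x: "x \<notin> kinks"
  shows "(step_velocity a has_real_derivative step_velocity_deriv a x) (at x)"
    and "(step_velocity_deriv a has_real_derivative
           a * sgn (sin (2*x) * cos (2*x)) - 4 * step_velocity a x) (at x)"
proof -
  define s c \<sigma> \<tau> where "s = sin (2*x)" and "c = cos (2*x)" and "\<sigma> = sgn s" and "\<tau> = sgn c"
  have nz: "s \<noteq> 0" "c \<noteq> 0" using x by (auto simp: kinks_def s_def c_def)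
  have sq: "\<sigma> * \<sigma> = 1" "\<tau> * \<tau> = 1" using nz by (auto simp: \<sigma>_def \<tau>_def sgn_if)
  have abs: "\<bar>s\<bar> = \<sigma> * s" "\<bar>c\<bar> = \<tau> * c" by (auto simp: \<sigma>_def \<tau>_def sgn_if)
  have one: "s * s + c * c = 1" using sin_cos_squared_add[of "2*x"] by (simp add: s_def c_def power2_eq_square)
  have pos: "0 < 1 + \<bar>c\<bar> + \<bar>s\<bar>" by simp
  have ds: "((\<lambda>x. sin (2*x)) has_real_derivative 2 * c) (at x)"
    by (auto intro!: derivative_eq_intros simp: c_def)
  have dc: "((\<lambda>x. cos (2*x)) has_real_derivative - 2 * s) (at x)"
    by (auto intro!: derivative_eq_intros simp: s_def)
  have das: "((\<lambda>x. \<bar>sin (2*x)\<bar>) has_real_derivative \<sigma> * (2 * c)) (at x)"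
    unfolding \<sigma>_def s_def by (rule DERIV_abs) (use ds nz in \<open>auto simp: s_def c_def\<close>)
  have dac: "((\<lambda>x. \<bar>cos (2*x)\<bar>) has_real_derivative \<tau> * (- 2 * s)) (at x)"
    unfolding \<tau>_def c_def by (rule DERIV_abs) (use dc nz in \<open>auto simp: s_def c_def\<close>)
  define W where "W = 1 + \<tau> * c + \<sigma> * s"
  have W0: "W \<noteq> 0" using pos by (simp add: W_def abs)
  have "(step_velocity a has_real_derivative
     ((- (a/2) * (2 * c * c + (- 2 * s) * s)) * (1 + \<bar>c\<bar> + \<bar>s\<bar>)
       - (- (a/2) * (s * c)) * (\<tau> * (- 2 * s) + \<sigma> * (2 * c)))
      / ((1 + \<bar>c\<bar> + \<bar>s\<bar>) * (1 + \<bar>c\<bar> + \<bar>s\<bar>))) (at x)"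
    unfolding step_velocity_def[abs_def] s_def c_def
    by (rule derivative_eq_intros ds dc das dac refl | use pos in \<open>simp add: s_def c_def\<close>)+
  also have "((- (a/2) * (2 * c * c + (- 2 * s) * s)) * (1 + \<bar>c\<bar> + \<bar>s\<bar>)
       - (- (a/2) * (s * c)) * (\<tau> * (- 2 * s) + \<sigma> * (2 * c)))
      / ((1 + \<bar>c\<bar> + \<bar>s\<bar>) * (1 + \<bar>c\<bar> + \<bar>s\<bar>)) = step_velocity_deriv a x"
  proof -
    have N: "(- (a/2) * (2 * c * c + (- 2 * s) * s)) * W - (- (a/2) * (s * c)) * (\<tau> * (- 2 * s) + \<sigma> * (2 * c))
        = (a/2) * (\<sigma> * s - \<tau> * c) * (W * W)"
      unfolding W_def using sq one by algebra
    have D: "step_velocity_deriv a x = (a/2) * (\<sigma> * s - \<tau> * c)"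
      by (simp only: step_velocity_deriv_def abs flip: s_def c_def)
    have W: "1 + \<bar>c\<bar> + \<bar>s\<bar> = W"
      by (simp only: W_def abs)
    show ?thesis
      unfolding W N D using W0 by simp
  qed
  finally show "(step_velocity a has_real_derivative step_velocity_deriv a x) (at x)" .
  have "(step_velocity_deriv a has_real_derivative (a/2) * (\<sigma> * (2 * c) - \<tau> * (- 2 * s))) (at x)"
    unfolding step_velocity_deriv_def[abs_def] by (intro DERIV_cmult DERIV_diff das dac)
  also have "(a/2) * (\<sigma> * (2 * c) - \<tau> * (- 2 * s)) = a * sgn (s * c) - 4 * step_velocity a x"
  proof -
    have "(a/2) * (\<sigma> * (2 * c) - \<tau> * (- 2 * s)) * W = a * (\<sigma> * \<tau>) * W + 2 * a * (s * c)"
      unfolding W_def using sq one by algebra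
    then have "(a/2) * (\<sigma> * (2 * c) - \<tau> * (- 2 * s)) = a * (\<sigma> * \<tau>) + 2 * a * (s * c) / W"
      using W0 by (simp add: field_simps)
    moreover have "step_velocity a x = - (a/2) * (s * c) / W"
      by (simp only: step_velocity_def abs W_def flip: s_def c_def)
    moreover have "sgn (s * c) = \<sigma> * \<tau>"
      by (simp add: sgn_mult \<sigma>_def \<tau>_def)
    ultimately show ?thesis by simp
  qed
  finally show "(step_velocity_deriv a has_real_derivative
           a * sgn (sin (2*x) * cos (2*x)) - 4 * step_velocity a x) (at x)"
    by (simp add: s_def c_def)
qed

lemma continuous_on_step_velocity: "continuous_on S (step_velocity a)"
proof -
  have "1 + \<bar>cos (2*x)\<bar> + \<bar>sin (2*x)\<bar> \<noteq> 0" for x :: real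
    by linarith
  then show ?thesis
    unfolding step_velocity_def[abs_def] by (intro continuous_intros) auto
qed

lemma continuous_on_step_velocity_deriv: "continuous_on S (step_velocity_deriv a)"
  unfolding step_velocity_deriv_def[abs_def] by (intro continuous_intros)

lemma step_velocity_period: "step_velocity a (x + pi/2) = step_velocity a x"
  by (simp add: step_velocity_def distrib_left)

lemma periodic_ext_odd_step:
  assumes "x \<notin> kinks"
  shows "periodic_ext (odd_step a) x = a * sgn (sin (2*x) * cos (2*x))"
proof -
  obtain n y where x: "x = y + of_int n * (pi/2)" and y: "y \<in> {- (pi/4)..<pi/4}"
    by (rule quarter_period_decomp)
  have "2 * x = 2 * y + of_int n * pi" by (simp add: x)
  moreover have "sin (of_int n * pi) = 0" by (simp add: sin_zero_iff_int2)
  moreover from this have "(cos (of_int n * pi))\<^sup>2 = 1"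
    using sin_cos_squared_add[of "of_int n * pi"] by simp
  ultimately have eq: "sin (2*x) * cos (2*x) = sin (2*y) * cos (2*y)"
    by (simp add: sin_add cos_add power2_eq_square algebra_simps)
  have nz: "sin (2*y) * cos (2*y) \<noteq> 0"
    using assms unfolding kinks_def mem_Collect_eq eq .
  then have "y \<noteq> - (pi/4)" "y \<noteq> 0" by auto
  with y have c: "0 < cos (2*y)" by (intro cos_gt_zero_pi) auto
  have "sgn (sin (2*y) * cos (2*y)) = sgn y"
  proof (cases "0 < y")
    case True
    then have "0 < sin (2*y)" using y by (intro sin_gt_zero) auto
    with c True show ?thesis by (simp add: sgn_mult)
  next
    case False
    with \<open>y \<noteq> 0\<close> have "y < 0" by simp
    then have "0 < sin (- (2*y))" using y by (intro sin_gt_zero) auto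
    with c \<open>y < 0\<close> show ?thesis by (simp add: sgn_mult)
  qed
  then show ?thesis
    using periodic_ext_shift[OF y, of "odd_step a" n] eq by (simp add: odd_step_def x)
qed

text \<open>Shifting by pi/2 preserves the integral over a full period but flips its sign. It
  applies to the Fourier conditions because the step velocity has period pi/2 while exp(2ix) and
  exp(-2ix) change sign under this shift.\<close>

lemma has_integral_antiperiodic:
  fixes F :: "real \<Rightarrow> complex"
  assumes F: "continuous_on UNIV F" and anti: "\<And>x. F (x + pi/2) = - F x"
  shows "(F has_integral 0) {- pi..pi}"
proof -
  have per: "F (x + 2 * pi) = F x" for x
  proof -
    have "x + 2 * pi = x + pi/2 + pi/2 + pi/2 + pi/2" by simp
    then show ?thesis by (simp only: anti minus_minus)
  qed
  have int: "F integrable_on {-pi..pi}"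
    by (intro integrable_continuous_interval continuous_on_subset[OF F]) simp
  have "integral {-pi..-pi + 2*pi} F = integral {-pi + pi/2..-pi + pi/2 + 2*pi} F"
    by (rule integral_over_period[OF F per, symmetric]) auto
  also have "\<dots> = integral {-pi..-pi + 2*pi} (\<lambda>x. F (x + pi/2))"
    using integral_shift_real_ivl[of "-pi + pi/2" "pi/2" "-pi + pi/2 + 2*pi" F] by simp
  also have "\<dots> = - integral {-pi..-pi + 2*pi} F"
    by (simp add: anti)
  finally have "integral {-pi..pi} F = 0"
    by simp
  with integrable_integral[OF int] show ?thesis by simp
qed

lemma circle_velocity_odd_step: "circle_velocity (odd_step a) (step_velocity a)"
  unfolding circle_velocity_def
proof (intro conjI exI[of _ "step_velocity_deriv a"] allI impI)
  show "step_velocity a (x + 2 * pi) = step_velocity a x" for x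
  proof -
    have "x + 2 * pi = x + pi/2 + pi/2 + pi/2 + pi/2" by simp
    then show ?thesis by (simp only: step_velocity_period)
  qed
  show "(step_velocity a has_real_derivative step_velocity_deriv a x) (at x)" for x
    by (rule DERIV_across_exceptional_points[OF continuous_on_step_velocity
          continuous_on_step_velocity_deriv finite_kinks step_velocity_ODE(1)])
  show "((\<lambda>x. periodic_ext (odd_step a) x - 4 * step_velocity a x) has_integral
      step_velocity_deriv a v - step_velocity_deriv a u) {u..v}" if "u \<le> v" for u v
    by (rule fundamental_theorem_of_calculus_strong[OF finite_kinks[of u v] that])
       (auto simp: periodic_ext_odd_step continuous_on_step_velocity_deriv
         intro: step_velocity_ODE(2) simp flip: has_real_derivative_iff_has_vector_derivative)
  have exp1: "exp (2 * \<i> * complex_of_real (x + pi/2)) = - exp (2 * \<i> * complex_of_real x)" for x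
  proof -
    have "2 * \<i> * complex_of_real (x + pi/2) = 2 * \<i> * complex_of_real x + \<i> * complex_of_real pi"
      by (simp add: algebra_simps)
    then show ?thesis by (simp only: exp_add exp_pi_i') simp
  qed
  have exp2: "exp (- 2 * \<i> * complex_of_real (x + pi/2)) = - exp (- 2 * \<i> * complex_of_real x)" for x
  proof -
    have "- 2 * \<i> * complex_of_real (x + pi/2) = - 2 * \<i> * complex_of_real x - \<i> * complex_of_real pi"
      by (simp add: algebra_simps)
    then show ?thesis by (simp only: exp_diff exp_pi_i') simp
  qed
  show "((\<lambda>x. complex_of_real (step_velocity a x) * exp (2 * \<i> * complex_of_real x)) has_integral 0) {- pi..pi}"
    by (rule has_integral_antiperiodic)
       (auto intro!: continuous_intros continuous_on_step_velocity simp only: step_velocity_period exp1 mult_minus_right)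
  show "((\<lambda>x. complex_of_real (step_velocity a x) * exp (- 2 * \<i> * complex_of_real x)) has_integral 0) {- pi..pi}"
    by (rule has_integral_antiperiodic)
       (auto intro!: continuous_intros continuous_on_step_velocity simp only: step_velocity_period exp2 mult_minus_right)
qed

text \<open>With $w = \tan\phi$ the flow of the step is the logistic equation $w' = -a w (1 - |w|)$.\<close>

definition step_flow :: "real \<Rightarrow> real \<Rightarrow> real \<Rightarrow> real" where
  "step_flow a t \<theta> = arctan (tan \<theta> / (\<bar>tan \<theta>\<bar> + (1 - \<bar>tan \<theta>\<bar>) * exp (a * t)))"

text \<open>The rational parametrisation sin 2\<theta> = 2w/(1+w^2), cos 2\<theta> =
  (1-w^2)/(1+w^2). The condition |w| <= 1 makes the cosine nonnegative and describes exactly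
  \<theta> in \<open>Q\<close>.\<close>

lemma step_velocity_arctan:
  assumes "\<bar>w\<bar> \<le> 1"
  shows "2 * step_velocity a (arctan w) = - a * w * (1 - \<bar>w\<bar>) / (1 + w\<^sup>2)"
proof -
  define r where "r = 1 + w\<^sup>2"
  have r: "0 < r" using zero_le_power2[of w] unfolding r_def by linarith
  have w2: "w\<^sup>2 \<le> 1" using assms by (simp add: abs_square_le_1)
  have cos2: "(cos (arctan w))\<^sup>2 = 1 / r"
    unfolding cos_arctan power_divide r_def by simp
  have sin1: "sin (arctan w) = w * cos (arctan w)"
    by (simp add: sin_arctan cos_arctan)
  have "sin (2 * arctan w) = 2 * w * (cos (arctan w))\<^sup>2"
    unfolding sin_double sin1 by (simp add: power2_eq_square)
  then have s: "sin (2 * arctan w) = 2 * w / r"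
    unfolding cos2 by simp
  have "cos (2 * arctan w) = (1 - w\<^sup>2) * (cos (arctan w))\<^sup>2"
    unfolding cos_double sin1 by (simp add: power_mult_distrib left_diff_distrib)
  then have c: "cos (2 * arctan w) = (1 - w\<^sup>2) / r"
    unfolding cos2 by simp
  have den: "1 + \<bar>cos (2 * arctan w)\<bar> + \<bar>sin (2 * arctan w)\<bar> = 2 * (1 + \<bar>w\<bar>) / r"
  proof -
    have "\<bar>cos (2 * arctan w)\<bar> = (1 - w\<^sup>2) / r" "\<bar>sin (2 * arctan w)\<bar> = 2 * \<bar>w\<bar> / r"
      using r w2 by (simp_all add: s c abs_mult)
    moreover have "1 = (1 + w\<^sup>2) / r" using r by (simp add: r_def)
    ultimately have "1 + \<bar>cos (2 * arctan w)\<bar> + \<bar>sin (2 * arctan w)\<bar>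
        = (1 + w\<^sup>2) / r + (1 - w\<^sup>2) / r + 2 * \<bar>w\<bar> / r" by linarith
    then show ?thesis by (simp flip: add_divide_distrib)
  qed
  have "2 * step_velocity a (arctan w) = - a * (2 * w / r * ((1 - w\<^sup>2) / r)) / (2 * (1 + \<bar>w\<bar>) / r)"
    unfolding step_velocity_def den unfolding s c by simp
  also have "\<dots> = - a * w * ((1 - w\<^sup>2) / (1 + \<bar>w\<bar>)) / r"
  proof -
    have "- a * (2 * w / r * (p / r)) / (2 * q / r) = - a * w * (p / q) / r" if "0 < q" for p q :: real
      using r that by (simp add: field_simps)
    from this[of "1 + \<bar>w\<bar>" "1 - w\<^sup>2"] show ?thesis by linarith
  qed
  also have "1 - w\<^sup>2 = (1 - \<bar>w\<bar>) * (1 + \<bar>w\<bar>)"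
    by (simp add: algebra_simps power2_eq_square)
  finally show ?thesis by (simp add: r_def)
qed

lemma stationary_odd_step: "stationary_on_Q (odd_step a)"
proof -
  have odd: "odd_on Q (odd_step a)"
    by (simp add: odd_on_def odd_step_def sgn_minus)
  have "(\<lambda>x::real. sgn x) \<in> borel_measurable (lebesgue_on Q)"
    by (intro measurable_restrict_space1 measurable_completion) simp
  then have Linf: "Linf_on Q (odd_step a)"
    unfolding Linf_on_def odd_step_def[abs_def]
    by (auto intro!: borel_measurable_times exI[of _ "\<bar>a\<bar>"] simp: abs_mult sgn_if)
  have tan_le: "\<bar>tan \<theta>\<bar> \<le> 1" if "\<theta> \<in> Q" for \<theta>
  proof -
    have "tan \<theta> \<le> tan (pi/4)" "tan (- (pi/4)) \<le> tan \<theta>"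
      using that pi_gt_zero by (intro tan_mono_le; simp; linarith)+
    then show ?thesis by (simp add: tan_45)
  qed
  have flow: "step_flow a t \<theta> \<in> Q \<and>
      ((\<lambda>s. step_flow a s \<theta>) has_real_derivative 2 * step_velocity a (step_flow a t \<theta>)) (at t within {0..}) \<and>
      odd_step a (step_flow a t \<theta>) = odd_step a \<theta>" if \<theta>: "\<theta> \<in> Q" for t \<theta>
  proof -
    define u where "u = tan \<theta>"
    have u: "\<bar>u\<bar> \<le> 1" using tan_le[OF \<theta>] by (simp add: u_def)
    \<comment> \<open>The logistic solution with initial value u is u/D. As D >= |u| for either sign
      of \<open>a\<close>, it stays in [-1, 1], so the flow stays in \<open>Q\<close>.\<close>
    define D where "D = (\<lambda>t. \<bar>u\<bar> + (1 - \<bar>u\<bar>) * exp (a * t))"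
    have D_ge: "\<bar>u\<bar> \<le> D t" for t using u by (simp add: D_def)
    have D_pos: "0 < D t" for t
    proof (cases "u = 0")
      case False
      then show ?thesis using D_ge[of t] by linarith
    qed (simp add: D_def)
    define w where "w = u / D t"
    have w: "\<bar>w\<bar> \<le> 1" using D_ge[of t] D_pos[of t] by (simp add: w_def)
    have flow_eq: "step_flow a t \<theta> = arctan w"
      by (simp add: step_flow_def w_def D_def u_def)
    have "arctan w \<le> arctan 1" "arctan (- 1) \<le> arctan w"
      using w by (auto simp only: arctan_le_iff abs_le_iff minus_le_iff)
    then have 1: "step_flow a t \<theta> \<in> Q"
      by (simp add: flow_eq arctan_one arctan_minus)
    have one_w: "1 - \<bar>w\<bar> = (1 - \<bar>u\<bar>) * exp (a * t) / D t"
      using D_pos[of t] by (simp add: w_def D_def field_simps)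
    have "((\<lambda>t. u / D t) has_real_derivative - (u * ((1 - \<bar>u\<bar>) * (exp (a * t) * a))) / (D t * D t)) (at t within {0..})"
      using D_pos[of t] unfolding D_def by (auto intro!: derivative_eq_intros)
    also have "- (u * ((1 - \<bar>u\<bar>) * (exp (a * t) * a))) / (D t * D t) = - a * w * (1 - \<bar>w\<bar>)"
      unfolding one_w by (simp add: w_def)
    finally have "((\<lambda>t. arctan (u / D t)) has_real_derivative
        inverse (1 + (u / D t)\<^sup>2) * (- a * w * (1 - \<bar>w\<bar>))) (at t within {0..})"
      by (rule DERIV_chain2[OF DERIV_arctan])
    also have "inverse (1 + (u / D t)\<^sup>2) * (- a * w * (1 - \<bar>w\<bar>)) = - a * w * (1 - \<bar>w\<bar>) / (1 + w\<^sup>2)"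
      by (simp add: w_def divide_inverse)
    finally have "((\<lambda>t. arctan (u / D t)) has_real_derivative - a * w * (1 - \<bar>w\<bar>) / (1 + w\<^sup>2)) (at t within {0..})" .
    then have 2: "((\<lambda>s. step_flow a s \<theta>) has_real_derivative 2 * step_velocity a (step_flow a t \<theta>)) (at t within {0..})"
      unfolding flow_eq step_velocity_arctan[OF w] by (simp add: step_flow_def D_def u_def)
    have "sgn (arctan w) = sgn w"
      by (auto simp: sgn_if)
    also have "\<dots> = sgn u"
      using D_pos[of t] by (simp add: w_def sgn_divide)
    also have "\<dots> = sgn \<theta>"
    proof -
      have "0 < tan \<theta>" if "0 < \<theta>" using that \<theta> by (intro tan_gt_zero) auto
      moreover have "tan \<theta> < 0" if "\<theta> < 0"
        using that \<theta> tan_gt_zero[of "- \<theta>"] by auto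
      ultimately show ?thesis
        by (cases \<theta> "0::real" rule: linorder_cases) (auto simp: u_def)
    qed
    finally have 3: "odd_step a (step_flow a t \<theta>) = odd_step a \<theta>"
      by (simp add: odd_step_def flow_eq)
    from 1 2 3 show ?thesis by blast
  qed
  have init: "step_flow a 0 \<theta> = \<theta>" if "\<theta> \<in> Q" for \<theta>
  proof -
    have "- (pi/2) < \<theta>" "\<theta> < pi/2"
      using that pi_gt_zero by (simp_all only: atLeastAtMost_iff) linarith+
    then show ?thesis by (simp add: step_flow_def arctan_tan)
  qed
  show ?thesis
    unfolding stationary_on_Q_def solution_on_Q_def
    using odd Linf circle_velocity_odd_step[of a] flow init
    by (intro conjI exI[of _ "\<lambda>t. step_velocity a"] exI[of _ "step_flow a"]) auto
qed

section \<open>Asymptotics\<close>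

lemma continuous_bounded_by_Linf_norm:
  assumes "a < b" "continuous_on {a..b} f" "Linf_on {a..b} f" "x \<in> {a..b}"
  shows "\<bar>f x\<bar> \<le> Linf_norm {a..b} f"
  using assms AE_abs_le_Linf_norm by (intro continuous_AE_le[of a b f])

lemma odd_solution_flow:
  assumes sol: "solution_on_Q h0 h" and W: "\<forall>t\<ge>0. W1inf (- (pi/4)) (pi/4) (h t)"
    and "\<forall>\<theta>\<in>{0..pi/4}. 0 \<le> h0 \<theta>" "\<And>\<theta>. \<theta> \<in> {pi/4 - d..pi/4} \<Longrightarrow> v \<le> h0 \<theta>"
    and "0 < d" "d < pi/4" "0 < v"
  obtains H \<phi> where "odd_flow h0 h H \<phi> v d"
proof -
  obtain H \<phi> where H: "\<And>t. t \<ge> 0 \<Longrightarrow> circle_velocity (h t) (H t)"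
    and init: "\<And>\<theta>. \<theta> \<in> Q \<Longrightarrow> \<phi> 0 \<theta> = \<theta>"
    and flow: "\<And>t \<theta>. t \<ge> 0 \<Longrightarrow> \<theta> \<in> Q \<Longrightarrow> \<phi> t \<theta> \<in> Q \<and>
           ((\<lambda>s. \<phi> s \<theta>) has_real_derivative 2 * H t (\<phi> t \<theta>)) (at t within {0..}) \<and>
           h t (\<phi> t \<theta>) = h0 \<theta>"
    using sol unfolding solution_on_Q_def by blast
  have contQ: "continuous_on Q (h t)" if "0 \<le> t" for t
    using W that by (auto simp: W1inf_def)
  have "odd_flow h0 h H \<phi> v d"
  proof
    show "\<exists>B. \<forall>t\<in>{0..T}. \<forall>x\<in>{0..pi/4}. \<bar>h t x\<bar> \<le> B" for T
    proof -
      obtain B where B: "\<And>t. t \<in> {0..T} \<Longrightarrow> Linf_norm Q (h t) \<le> B"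
        using sol unfolding solution_on_Q_def by blast
      have "\<bar>h t x\<bar> \<le> B" if "t \<in> {0..T}" "x \<in> {0..pi/4}" for t x
      proof -
        have "Linf_on Q (h t)"
          using sol that unfolding solution_on_Q_def by auto
        then have "\<bar>h t x\<bar> \<le> Linf_norm Q (h t)"
          using that contQ[of t] by (intro continuous_bounded_by_Linf_norm) auto
        with B[OF that(1)] show ?thesis by linarith
      qed
      then show ?thesis by blast
    qed
    show "continuous_on {0..pi/4} (h t)" if "0 \<le> t" for t
      by (rule continuous_on_subset[OF contQ[OF that]]) auto
    show "odd_on Q (h t)" if "0 \<le> t" for t
      using sol that unfolding solution_on_Q_def by blast
  qed (use assms H init flow in auto)
  then show ?thesis by (rule that)
qed

text \<open>Dominated convergence: the limit holds pointwise on the open interval, and transport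
  keeps |h| below the maximum B of |h0|, so 2B dominates.\<close>

lemma (in odd_flow) L1_convergence:
  assumes lip: "L-lipschitz_on {0..pi/4} h0"
  shows "((\<lambda>t. LINT \<theta>|lebesgue_on {0<..<pi/4}. \<bar>h t \<theta> - h0 (pi/4)\<bar>) \<longlongrightarrow> 0) at_top"
proof -
  obtain B where B: "\<And>\<theta>. \<theta> \<in> {0..pi/4} \<Longrightarrow> \<bar>h0 \<theta>\<bar> \<le> B"
  proof -
    have "bounded (h0 ` {0..pi/4})"
      by (intro compact_imp_bounded compact_continuous_image lipschitz_on_continuous_on[OF lip]) simp
    then obtain B where "\<forall>\<theta>\<in>{0..pi/4}. \<bar>h0 \<theta>\<bar> \<le> B"
      by (auto simp: bounded_iff)
    then show ?thesis by (intro that) blast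
  qed
  \<comment> \<open>The convergence theorem asks for measurability at every real t, but nothing is
    known about \<open>h\<close> at negative times.\<close>
  define g where "g = (\<lambda>t \<theta>. \<bar>h (max 0 t) \<theta> - h0 (pi/4)\<bar>)"
  have fin: "emeasure (lebesgue_on {0<..<pi/4}) (space (lebesgue_on {0<..<pi/4})) < \<infinity>"
    by (simp add: emeasure_restrict_space)
  have "((\<lambda>t. LINT \<theta>|lebesgue_on {0<..<pi/4}. g t \<theta>) \<longlongrightarrow> (LINT \<theta>|lebesgue_on {0<..<pi/4}. 0)) at_top"
  proof (rule integral_dominated_convergence_at_top[where w="\<lambda>_. 2 * B"])
    show "g t \<in> borel_measurable (lebesgue_on {0<..<pi/4})" for t
    proof (rule continuous_imp_measurable_on_sets_lebesgue)
      have "continuous_on {0<..<pi/4} (h (max 0 t))"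
        by (rule continuous_on_subset[OF cont]) auto
      then show "continuous_on {0<..<pi/4} (g t)"
        unfolding g_def by (intro continuous_intros)
    qed simp
    show "integrable (lebesgue_on {0<..<pi/4}) (\<lambda>_. 2 * B)"
      using fin by (intro finite_measure.integrable_const finite_measureI) auto
    have "\<bar>g t \<theta>\<bar> \<le> 2 * B" if "\<theta> \<in> {0<..<pi/4}" for t \<theta>
    proof -
      have "\<bar>h (max 0 t) \<theta>\<bar> \<le> B"
        by (rule transported_bound[OF _ _ B]) (use that in auto)
      moreover have "\<bar>h0 (pi/4)\<bar> \<le> B" by (rule B) simp
      ultimately show ?thesis by (simp add: g_def)
    qed
    then show "\<forall>\<^sub>F t in at_top. AE \<theta> in lebesgue_on {0<..<pi/4}. norm (g t \<theta>) \<le> 2 * B"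
      by (intro always_eventually allI AE_I2) auto
    show "AE \<theta> in lebesgue_on {0<..<pi/4}. ((\<lambda>t. g t \<theta>) \<longlongrightarrow> 0) at_top"
    proof (rule AE_I2)
      fix \<theta> assume "\<theta> \<in> space (lebesgue_on {0<..<pi/4})"
      then have "((\<lambda>t. h t \<theta>) \<longlongrightarrow> h0 (pi/4)) at_top"
        by (intro transported_tendsto[OF _ lip]) simp
      then have "((\<lambda>t. \<bar>h t \<theta> - h0 (pi/4)\<bar>) \<longlongrightarrow> 0) at_top"
        by (intro tendsto_rabs_zero LIM_zero)
      then show "((\<lambda>t. g t \<theta>) \<longlongrightarrow> 0) at_top"
        by (rule Lim_transform_eventually)
           (auto simp: g_def intro: eventually_mono[OF eventually_ge_at_top[of 0]])
    qed
  qed simp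
  then have "((\<lambda>t. LINT \<theta>|lebesgue_on {0<..<pi/4}. g t \<theta>) \<longlongrightarrow> 0) at_top"
    by simp
  then show ?thesis
    by (rule Lim_transform_eventually)
       (auto simp: g_def intro: eventually_mono[OF eventually_ge_at_top[of 0]])
qed

text \<open>With Lipschitz constant M, moving this far from pi/4 lowers the value a by at most
  a/2.\<close>

definition growth_width :: "real \<Rightarrow> real \<Rightarrow> real" where
  "growth_width M a = a / (2 * M)"

text \<open>This is 4 kappa for v = a/2. The guard holds for every admissible h0; the value 1
  elsewhere keeps the constant positive for all arguments. \<open>growth_const\<close> is 2 v tan 2d
  with the same guard.\<close>

definition growth_rate :: "real \<Rightarrow> real \<Rightarrow> real" where
  "growth_rate M a = (if 0 < a \<and> a \<le> M * (pi/4) then a / 8 * (1 - cos (4 * growth_width M a)) else 1)"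

definition growth_const :: "real \<Rightarrow> real \<Rightarrow> real" where
  "growth_const M a = (if 0 < a \<and> a \<le> M * (pi/4) then a * tan (2 * growth_width M a) else 1)"

lemma growth_width:
  assumes "0 < a" "a \<le> M * (pi/4)"
  shows "0 < growth_width M a" "growth_width M a \<le> pi/8"
proof -
  have "0 < M"
    using assms by (smt (verit) mult_nonneg_nonneg mult_nonpos_nonneg pi_gt_zero divide_pos_pos)
  then show "0 < growth_width M a" "growth_width M a \<le> pi/8"
    using assms by (simp_all add: growth_width_def field_simps)
qed

lemma growth_pos: "0 < growth_rate M a" "0 < growth_const M a"
proof -
  have "cos (4 * growth_width M a) < cos 0" "0 < tan (2 * growth_width M a)"
    if "0 < a" "a \<le> M * (pi/4)"
    using growth_width[OF that] by (intro cos_monotone_0_pi tan_gt_zero; simp)+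
  then show "0 < growth_rate M a" "0 < growth_const M a"
    by (simp_all add: growth_rate_def growth_const_def)
qed

lemma odd_solution_asymptotics:
  assumes W0: "W1inf (- (pi/4)) (pi/4) h0" and odd0: "odd_on Q h0"
    and nonneg: "\<forall>\<theta>\<in>{0..pi/4}. 0 \<le> h0 \<theta>" and sol: "solution_on_Q h0 h"
    and W: "\<forall>t\<ge>0. W1inf (- (pi/4)) (pi/4) (h t)" and a: "0 < h0 (pi/4)"
  shows "((\<lambda>t. LINT \<theta>|lebesgue_on {0<..<pi/4}. \<bar>h t \<theta> - h0 (pi/4)\<bar>) \<longlongrightarrow> 0) at_top"
    and "0 \<le> t \<Longrightarrow> growth_const (W1inf_norm (- (pi/4)) (pi/4) h0) (h0 (pi/4))
             * exp (growth_rate (W1inf_norm (- (pi/4)) (pi/4) h0) (h0 (pi/4)) * t)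
          \<le> Linf_norm {- (pi/4)<..<pi/4} (weak_deriv (- (pi/4)) (pi/4) (h t))"
proof -
  define M where "M = W1inf_norm (- (pi/4)) (pi/4) h0"
  define a where "a = h0 (pi/4)"
  have sub: "{0..pi/4} \<subseteq> Q" by auto
  have lip: "M-lipschitz_on {0..pi/4} h0"
  proof (rule lipschitz_on_subset[OF lipschitz_on_le[OF W1inf_imp_lipschitz[OF W0]] sub])
    have "0 \<le> Linf_norm {- (pi/4)<..<pi/4} h0"
      using W0 by (intro Linf_norm_interval_nonneg) (auto simp: W1inf_def)
    then show "Linf_norm {- (pi/4)<..<pi/4} (weak_deriv (- (pi/4)) (pi/4) h0) \<le> M"
      by (simp add: M_def W1inf_norm_def)
  qed simp
  have "h0 0 = 0"
    using odd0[unfolded odd_on_def, rule_format, of 0] by simp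
  \<comment> \<open>Oddness gives h0(0) = 0, so the Lipschitz bound across [0, pi/4] limits a. This
    yields d <= pi/8 and activates the guarded branch of the constants.\<close>
  then have aM: "0 < a" "a \<le> M * (pi/4)"
    using lipschitz_onD[OF lip, of "pi/4" 0] a by (simp_all add: a_def dist_real_def)
  define d where "d = growth_width M a"
  have d: "0 < d" "d \<le> pi/8" unfolding d_def using growth_width[OF aM] by auto
  have "0 < M" using d aM by (auto simp: d_def growth_width_def zero_less_divide_iff)
  have lower: "a / 2 \<le> h0 \<theta>" if "\<theta> \<in> {pi/4 - d..pi/4}" for \<theta>
  proof -
    have "\<bar>h0 \<theta> - a\<bar> \<le> M * \<bar>\<theta> - pi/4\<bar>"
      using lipschitz_onD[OF lip, of \<theta> "pi/4"] that d by (simp add: a_def dist_real_def)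
    also have "\<dots> \<le> M * d"
      using that \<open>0 < M\<close> by (intro mult_left_mono) auto
    also have "\<dots> = a / 2"
      using \<open>0 < M\<close> by (simp add: d_def growth_width_def)
    finally show ?thesis by linarith
  qed
  obtain H \<phi> where "odd_flow h0 h H \<phi> (a / 2) d"
    by (rule odd_solution_flow[OF sol W nonneg lower]) (use d aM in auto)
  then interpret odd_flow h0 h H \<phi> "a / 2" d .
  show "((\<lambda>t. LINT \<theta>|lebesgue_on {0<..<pi/4}. \<bar>h t \<theta> - h0 (pi/4)\<bar>) \<longlongrightarrow> 0) at_top"
    by (rule L1_convergence[OF lip])
  assume t: "0 \<le> t"
  have "(Linf_norm {- (pi/4)<..<pi/4} (weak_deriv (- (pi/4)) (pi/4) (h t)))-lipschitz_on {0..pi/4} (h t)"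
    by (rule lipschitz_on_subset[OF W1inf_imp_lipschitz sub]) (use W t in auto)
  from gradient_growth[OF t this]
  have "a * tan (2 * d) * exp (4 * rate * t)
      \<le> Linf_norm {- (pi/4)<..<pi/4} (weak_deriv (- (pi/4)) (pi/4) (h t))"
    by simp
  moreover have "growth_const M a = a * tan (2 * d)" "growth_rate M a = 4 * rate"
    unfolding rate_def using aM by (simp_all add: growth_const_def growth_rate_def d_def)
  ultimately show "growth_const (W1inf_norm (- (pi/4)) (pi/4) h0) (h0 (pi/4))
             * exp (growth_rate (W1inf_norm (- (pi/4)) (pi/4) h0) (h0 (pi/4)) * t)
          \<le> Linf_norm {- (pi/4)<..<pi/4} (weak_deriv (- (pi/4)) (pi/4) (h t))"
    by (simp flip: M_def a_def)
qed

theorem theorem4: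
  shows "\<exists>c C :: real \<Rightarrow> real \<Rightarrow> real.
    (\<forall>M a. 0 < c M a \<and> 0 < C M a) \<and>
    (\<forall>(h0 :: real \<Rightarrow> real) (h :: real \<Rightarrow> real \<Rightarrow> real).
       W1inf (- (pi/4)) (pi/4) h0 \<and>
       odd_on Q h0 \<and>
       (\<forall>\<theta>\<in>{0..pi/4}. 0 \<le> h0 \<theta>) \<and>
       solution_on_Q h0 h \<and>
       (\<forall>t\<ge>0. W1inf (- (pi/4)) (pi/4) (h t)) \<and>
       0 < h0 (pi/4)
       \<longrightarrow>
       stationary_on_Q (odd_step (h0 (pi/4))) \<and>
       ((\<lambda>t. LINT \<theta>|lebesgue_on {0<..<pi/4}. \<bar>h t \<theta> - h0 (pi/4)\<bar>)
          \<longlongrightarrow> 0) at_top \<and>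
       (\<forall>t\<ge>0. Linf_norm {- (pi/4)<..<pi/4} (weak_deriv (- (pi/4)) (pi/4) (h t))
          \<ge> C (W1inf_norm (- (pi/4)) (pi/4) h0) (h0 (pi/4))
             * exp (c (W1inf_norm (- (pi/4)) (pi/4) h0) (h0 (pi/4)) * t)))"
  by (intro exI[of _ growth_rate] exI[of _ growth_const] conjI allI impI growth_pos stationary_odd_step)
     (elim conjE, (rule odd_solution_asymptotics; assumption))+

end
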